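(* Let $(A,\cdot,\Delta_A)$ be an anti-flexible bialgebra and $V$ a vector space. Let there be given linear maps $\triangleright:A\otimes V\to V$, $\triangleleft:V\otimes A\to V$, $\theta:A\otimes A\to V$, $P:A\to V\otimes V$, $\cdot_V:V\otimes V\to V$, $\phi:A\to V\otimes A$, $\psi:A\to A\otimes V$, $\rho:V\to A\otimes V$, $\gamma:V\to V\otimes A$, $\Delta_V:V\to V\otimes V$ (an extending datum of $A$ by $V$ of type (I)). Consider on $A\oplus V$ the multiplication $$(a,x)(b,y):=(ab,\ xy+a\triangleright y+x\triangleleft b+\theta(a,b))$$ and the comultiplication $$\Delta_E(a)=\Delta_A(a)+\phi(a)+\psi(a)+P(a),\qquad \Delta_E(x)=\Delta_V(x)+\rho(x)+\gamma(x).$$ Then $A\oplus V$ with this multiplication and comultiplication (the unified biproduct $A^{P}\#_{\theta}V$) is an anti-flexible bialgebra if and only if the multiplication makes $A\oplus V$ an anti-flexible algebra, the comultiplication makes $A\oplus V$ an anti-flexible coalgebra, and the following hold for all $a,b\in A$, $x,y\in V$: (E1) $\phi(ab)+\tau\psi(ba)+\gamma(\theta(a,b))+\tau\rho(\theta(b,a))=\theta(b,a_2)\otimes a_1+(b\triangleright a_{(1)})\otimes a_{(0)}+b_{(1)}\otimes b_{(0)}a+\theta(a_1,b)\otimes a_2+(a_{(-1)}\triangleleft b)\otimes a_{(0)}+b_{(-1)}\otimes ab_{(0)}$; (E2) $\rho(xy)+\tau\gamma(yx)=y_{[1]}\otimes y_{[0]}x+y_{[-1]}\otimes xy_{[0]}$;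 (E3) $\Delta_V(a\triangleright y)+\tau\Delta_V(y\triangleleft a)=(y\triangleleft a_{(0)})\otimes a_{(-1)}+ya_{<2>}\otimes a_{<1>}+y_2\otimes(y_1\triangleleft a)+y_{[0]}\otimes\theta(y_{[-1]},a)+(a_{(0)}\triangleright y)\otimes a_{(1)}+a_{<1>}y\otimes a_{<2>}+y_1\otimes(a\triangleright y_2)+y_{[0]}\otimes\theta(a,y_{[1]})$; (E4) $\Delta_V(\theta(a,b))+\tau\Delta_V(\theta(b,a))+P(ab)+\tau P(ba)=\theta(b,a_{(0)})\otimes a_{(-1)}+(b\triangleright a_{<2>})\otimes a_{<1>}+b_{(1)}\otimes\theta(b_{(0)},a)+b_{<2>}\otimes(b_{<1>}\triangleleft a)+\theta(a_{(0)},b)\otimes a_{(1)}+(a_{<1>}\triangleleft b)\otimes a_{<2>}+b_{(-1)}\otimes\theta(a,b_{(0)})+b_{<1>}\otimes(a\triangleright b_{<2>})$; (E5) $\gamma(x\triangleleft b)+\tau\rho(b\triangleright x)=(b\triangleright x_{[0]})\otimes x_{[-1]}+(x_{[0]}\triangleleft b)\otimes x_{[1]}$; (E6) $\rho(x\triangleleft b)+\tau\gamma(b\triangleright x)=bx_{[1]}\otimes x_{[0]}+b_2\otimes(b_1\triangleright x)+b_{(0)}\otimes b_{(-1)}x+x_{[-1]}b\otimes x_{[0]}+b_1\otimes(x\triangleleft b_2)+b_{(0)}\otimes xb_{(1)}$; (E7) $a_1\otimes\theta(a_2,b)+a_{(0)}\otimes(a_{(1)}\triangleleft b)+ab_{(0)}\otimes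 b_{(1)}-b_1\otimes\theta(b_2,a)-b_{(0)}\otimes(b_{(1)}\triangleleft a)-ba_{(0)}\otimes a_{(1)}=\tau\big(a_{(-1)}\otimes a_{(0)}b+\theta(a,b_1)\otimes b_2+(a\triangleright b_{(-1)})\otimes b_{(0)}-b_{(-1)}\otimes b_{(0)}a-\theta(b,a_1)\otimes a_2-(b\triangleright a_{(-1)})\otimes a_{(0)}\big)$; (E8) $(\mathrm{id}-\tau)(a_{(-1)}\otimes\theta(a_{(0)},b)+a_{<1>}\otimes(a_{<2>}\triangleleft b)+\theta(a,b_{(0)})\otimes b_{(1)}+(a\triangleright b_{<1>})\otimes b_{<2>})=(\mathrm{id}-\tau)(b_{(-1)}\otimes\theta(b_{(0)},a)+b_{<1>}\otimes(b_{<2>}\triangleleft a)+\theta(b,a_{(0)})\otimes a_{(1)}+(b\triangleright a_{<1>})\otimes a_{<2>})$; (E9) $x_{[0]}\otimes x_{[1]}b+(x\triangleleft b_1)\otimes b_2+xb_{(-1)}\otimes b_{(0)}-(b\triangleright x_{[0]})\otimes x_{[1]}=\tau\big(x_{[-1]}\otimes(x_{[0]}\triangleleft b)-b_1\otimes(b_2\triangleright x)-b_{(0)}\otimes b_{(1)}x-bx_{[-1]}\otimes x_{[0]}\big)$; (E10) $(\mathrm{id}-\tau)(x_1\otimes(x_2\triangleleft b)+x_{[0]}\otimes\theta(x_{[1]},b)+(x\triangleleft b_{(0)})\otimes b_{(1)}+xb_{<1>}\otimes b_{<2>})=(\mathrm{id}-\tau)(b_{(-1)}\otimes(b_{(0)}\triangleright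 x)+b_{<1>}\otimes b_{<2>}x+(b\triangleright x_1)\otimes x_2+\theta(b,x_{[-1]})\otimes x_{[0]})$; (E12) $xy_{[0]}\otimes y_{[1]}-yx_{[0]}\otimes x_{[1]}=\tau\big(x_{[-1]}\otimes x_{[0]}y-y_{[-1]}\otimes y_{[0]}x\big)$; (E13) $\Delta_V(xy)+\tau\Delta_V(yx)=yx_2\otimes x_1+y_2\otimes y_1x+x_1y\otimes x_2+y_1\otimes xy_2+(y\triangleleft x_{[1]})\otimes x_{[0]}+y_{[0]}\otimes(y_{[-1]}\triangleright x)+(x_{[-1]}\triangleright y)\otimes x_{[0]}+y_{[0]}\otimes(x\triangleleft y_{[1]})$; (E14) $(\mathrm{id}-\tau)(x_1\otimes x_2y+xy_1\otimes y_2-y_1\otimes y_2x-yx_1\otimes x_2)+(\mathrm{id}-\tau)(x_{[0]}\otimes(x_{[1]}\triangleright y)+(x\triangleleft y_{[-1]})\otimes y_{[0]}-y_{[0]}\otimes(y_{[1]}\triangleright x)-(y\triangleleft x_{[-1]})\otimes x_{[0]})=0$. Conversely, if $E$ is a vector space containing $A$ as a subspace with complement $V$, then any anti-flexible bialgebra structure on $E$ for which the canonical projection $p:E=A\oplus V\to A$ is both an algebra homomorphism and a coalgebra homomorphism is of this form.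
   Context: Vector spaces are over a fixed field of characteristic zero; $\tau(u\otimes v)=v\otimes u$, $\tau_{13}(u\otimes v\otimes w)=w\otimes v\otimes u$. Sigma notation: $\Delta_A(a)=a_1\otimes a_2$, $\Delta_V(x)=x_1\otimes x_2$, $\phi(a)=a_{(-1)}\otimes a_{(0)}$, $\psi(a)=a_{(0)}\otimes a_{(1)}$, $\rho(x)=x_{[-1]}\otimes x_{[0]}$, $\gamma(x)=x_{[0]}\otimes x_{[1]}$, $P(a)=a_{<1>}\otimes a_{<2>}$; $xy=x\cdot_Vy$ for $x,y\in V$. Anti-flexible algebra: bilinear product with $(ab)c-a(bc)=(cb)a-c(ba)$. Anti-flexible coalgebra: linear $\Delta$ with $T=\tau_{13}T$, $T=(\Delta\otimes\mathrm{id})\Delta-(\mathrm{id}\otimes\Delta)\Delta$. Anti-flexible bialgebra: both, with $\Delta(ab)+\tau\Delta(ba)=a_1b\otimes a_2+ba_2\otimes a_1+b_1\otimes ab_2+b_2\otimes b_1a$ and $(\mathrm{id}-\tau)(a_1\otimes a_2b+ab_1\otimes b_2-ba_1\otimes a_2-b_1\otimes b_2a)=0$ for all $a,b$. *)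

theory Defs
  imports "HOL-Analysis.Product_Vector" "HOL-Library.Function_Algebras"
begin

section \<open>Multilinear maps and tensor products\<close>

text \<open>
  The library has no tensor product of vector spaces over a field.  Here \<open>A \<otimes> B\<close> is the span of the
  evaluations \<open>a \<otimes> b = (\<beta> \<mapsto> \<beta> a b)\<close> in the space of functionals on bilinear forms
  \<open>\<beta> : A \<times> B \<rightarrow> k\<close>.  HOL functions are total, so evaluations are set to \<open>0\<close> at arguments that
  are not bilinear.  The theorems \<open>tensor2_universal\<close> and \<open>tensor3_universal\<close> below show that this is
  the tensor product.
\<close>

definition bilinear_map ::
  "('k::field \<Rightarrow> 'a::ab_group_add \<Rightarrow> 'a) \<Rightarrow> ('k \<Rightarrow> 'b::ab_group_add \<Rightarrow> 'b) \<Rightarrow>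
   ('k \<Rightarrow> 'c::ab_group_add \<Rightarrow> 'c) \<Rightarrow> ('a \<Rightarrow> 'b \<Rightarrow> 'c) \<Rightarrow> bool" where
  "bilinear_map sA sB sC F \<longleftrightarrow>
     (\<forall>a. Vector_Spaces.linear sB sC (F a)) \<and> (\<forall>b. Vector_Spaces.linear sA sC (\<lambda>a. F a b))"

definition trilinear_map ::
  "('k::field \<Rightarrow> 'a::ab_group_add \<Rightarrow> 'a) \<Rightarrow> ('k \<Rightarrow> 'b::ab_group_add \<Rightarrow> 'b) \<Rightarrow>
   ('k \<Rightarrow> 'c::ab_group_add \<Rightarrow> 'c) \<Rightarrow> ('k \<Rightarrow> 'd::ab_group_add \<Rightarrow> 'd) \<Rightarrow>
   ('a \<Rightarrow> 'b \<Rightarrow> 'c \<Rightarrow> 'd) \<Rightarrow> bool" where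
  "trilinear_map sA sB sC sD F \<longleftrightarrow>
     (\<forall>a b. Vector_Spaces.linear sC sD (\<lambda>c. F a b c)) \<and>
     (\<forall>a c. Vector_Spaces.linear sB sD (\<lambda>b. F a b c)) \<and>
     (\<forall>b c. Vector_Spaces.linear sA sD (\<lambda>a. F a b c))"

definition fscale :: "'k::field \<Rightarrow> ('x \<Rightarrow> 'k) \<Rightarrow> 'x \<Rightarrow> 'k" where
  "fscale c \<xi> = (\<lambda>\<beta>. c * \<xi> \<beta>)"

lemma vector_space_fscale: "vector_space fscale"
  by unfold_locales (auto simp: fscale_def fun_eq_iff algebra_simps)

lemma vector_space_field: "vector_space ((*) :: 'k::field \<Rightarrow> 'k \<Rightarrow> 'k)"
  by unfold_locales (auto simp: algebra_simps)

type_synonym ('a, 'b, 'k) tensor2 = "('a \<Rightarrow> 'b \<Rightarrow> 'k) \<Rightarrow> 'k"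
type_synonym ('a, 'b, 'c, 'k) tensor3 = "('a \<Rightarrow> 'b \<Rightarrow> 'c \<Rightarrow> 'k) \<Rightarrow> 'k"

definition tens ::
  "('k::field \<Rightarrow> 'a::ab_group_add \<Rightarrow> 'a) \<Rightarrow> ('k \<Rightarrow> 'b::ab_group_add \<Rightarrow> 'b) \<Rightarrow>
   'a \<Rightarrow> 'b \<Rightarrow> ('a, 'b, 'k) tensor2" where
  "tens sA sB a b = (\<lambda>\<beta>. if bilinear_map sA sB (*) \<beta> then \<beta> a b else 0)"

definition tens3 ::
  "('k::field \<Rightarrow> 'a::ab_group_add \<Rightarrow> 'a) \<Rightarrow> ('k \<Rightarrow> 'b::ab_group_add \<Rightarrow> 'b) \<Rightarrow>
   ('k \<Rightarrow> 'c::ab_group_add \<Rightarrow> 'c) \<Rightarrow> 'a \<Rightarrow> 'b \<Rightarrow> 'c \<Rightarrow> ('a, 'b, 'c, 'k) tensor3" where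
  "tens3 sA sB sC a b c = (\<lambda>t. if trilinear_map sA sB sC (*) t then t a b c else 0)"

definition tensor_space ::
  "('k::field \<Rightarrow> 'a::ab_group_add \<Rightarrow> 'a) \<Rightarrow> ('k \<Rightarrow> 'b::ab_group_add \<Rightarrow> 'b) \<Rightarrow>
   ('a, 'b, 'k) tensor2 set" where
  "tensor_space sA sB = module.span fscale {tens sA sB a b |a b. True}"

text \<open>
  \<open>sweedler \<xi> F\<close> is the linear extension of a bilinear \<open>F\<close>, applied to the tensor \<open>\<xi>\<close> (lemma
  \<open>sweedler_tens\<close>).  So \<open>sweedler (\<Delta> a) (\<lambda>a1 a2. F a1 a2)\<close> is what Sigma notation writes as
  \<open>F(a1, a2)\<close> with \<open>\<Delta>(a) = a1 \<otimes> a2\<close>.  The target of \<open>F\<close> is again a space of functionals, in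
  practice a tensor product.
\<close>

definition sweedler ::
  "('a, 'b, 'k::field) tensor2 \<Rightarrow> ('a \<Rightarrow> 'b \<Rightarrow> ('x \<Rightarrow> 'k)) \<Rightarrow> ('x \<Rightarrow> 'k)" where
  "sweedler \<xi> F = (\<lambda>\<beta>. \<xi> (\<lambda>u v. F u v \<beta>))"

definition tau :: "('a, 'b, 'k::field) tensor2 \<Rightarrow> ('b, 'a, 'k) tensor2" where
  "tau \<xi> = (\<lambda>\<beta>. \<xi> (\<lambda>u v. \<beta> v u))"

definition tau13 :: "('a, 'b, 'c, 'k::field) tensor3 \<Rightarrow> ('c, 'b, 'a, 'k) tensor3" where
  "tau13 \<xi> = (\<lambda>t. \<xi> (\<lambda>u v w. t w v u))"

definition id_minus_tau :: "('a, 'a, 'k::field) tensor2 \<Rightarrow> ('a, 'a, 'k) tensor2" where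
  "id_minus_tau \<xi> = \<xi> - tau \<xi>"

lemma tau_tens: "tau (tens sA sB a b) = tens sB sA b a"
  unfolding tau_def tens_def bilinear_map_def by (rule ext) (simp add: conj_commute)

lemma tau13_tens3: "tau13 (tens3 sA sB sC a b c) = tens3 sC sB sA c b a"
  unfolding tau13_def tens3_def trilinear_map_def by (rule ext) (auto simp: fun_eq_iff)

lemma sweedler_tens:
  assumes F: "bilinear_map sA sB fscale F"
  shows "sweedler (tens sA sB a b) F = F a b"
proof
  fix \<beta>
  have "bilinear_map sA sB (*) (\<lambda>u v. F u v \<beta>)"
    using F unfolding bilinear_map_def Vector_Spaces.linear_iff
    by (auto simp: fscale_def vector_space_field)
  thus "sweedler (tens sA sB a b) F \<beta> = F a b \<beta>"
    by (simp add: sweedler_def tens_def)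
qed

lemma linear_sweedler: "Vector_Spaces.linear fscale fscale (\<lambda>\<xi>. sweedler \<xi> F)"
  unfolding Vector_Spaces.linear_iff
  by (auto simp: vector_space_fscale sweedler_def fscale_def fun_eq_iff)

lemma linear_tau: "Vector_Spaces.linear fscale fscale tau"
  unfolding Vector_Spaces.linear_iff
  by (auto simp: vector_space_fscale tau_def fscale_def fun_eq_iff)

lemma linear_tau13: "Vector_Spaces.linear fscale fscale tau13"
  unfolding Vector_Spaces.linear_iff
  by (auto simp: vector_space_fscale tau13_def fscale_def fun_eq_iff)

lemma bilinear_map_compose:
  assumes "bilinear_map sA sB sC F" "Vector_Spaces.linear sC sD f"
  shows "bilinear_map sA sB sD (\<lambda>a b. f (F a b))"
  using assms unfolding bilinear_map_def Vector_Spaces.linear_iff by simp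

lemma trilinear_map_compose:
  assumes "trilinear_map sA sB sC sD F" "Vector_Spaces.linear sD sW f"
  shows "trilinear_map sA sB sC sW (\<lambda>a b c. f (F a b c))"
  using assms unfolding trilinear_map_def Vector_Spaces.linear_iff by simp

lemma bilinear_map_tens:
  assumes "vector_space sA" "vector_space sB"
  shows "bilinear_map sA sB fscale (tens sA sB)"
  using assms unfolding bilinear_map_def Vector_Spaces.linear_iff
  by (auto simp: vector_space_fscale tens_def fscale_def fun_eq_iff bilinear_map_def Vector_Spaces.linear_iff)

lemma trilinear_map_tens3:
  assumes "vector_space sA" "vector_space sB" "vector_space sC"
  shows "trilinear_map sA sB sC fscale (tens3 sA sB sC)"
  using assms unfolding trilinear_map_def Vector_Spaces.linear_iff
  by (auto simp: vector_space_fscale tens3_def fscale_def fun_eq_iff trilinear_map_def Vector_Spaces.linear_iff)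

lemma evaluation_lift:
  fixes e :: "'p \<Rightarrow> 'x \<Rightarrow> 'k::field" and F :: "'p \<Rightarrow> 'w::ab_group_add"
  assumes W: "vector_space sW"
    and sep: "\<And>f. Vector_Spaces.linear sW (*) f \<Longrightarrow> \<exists>\<beta>. \<forall>p. f (F p) = e p \<beta>"
  shows "\<exists>L. Vector_Spaces.linear fscale sW L \<and> (\<forall>p. L (e p) = F p)"
proof -
  interpret U: vector_space "fscale :: 'k \<Rightarrow> ('x \<Rightarrow> 'k) \<Rightarrow> 'x \<Rightarrow> 'k" by (rule vector_space_fscale)
  interpret W: vector_space sW by (rule W)
  interpret UW: vector_space_pair "fscale :: 'k \<Rightarrow> ('x \<Rightarrow> 'k) \<Rightarrow> 'x \<Rightarrow> 'k" sW by unfold_locales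
  interpret K: vector_space "(*) :: 'k \<Rightarrow> 'k \<Rightarrow> 'k" by (rule vector_space_field)
  interpret WK: vector_space_pair sW "(*) :: 'k \<Rightarrow> 'k \<Rightarrow> 'k" by unfold_locales
  interpret UK: vector_space_pair "fscale :: 'k \<Rightarrow> ('x \<Rightarrow> 'k) \<Rightarrow> 'x \<Rightarrow> 'k" "(*) :: 'k \<Rightarrow> 'k \<Rightarrow> 'k" by unfold_locales
  obtain B where B: "B \<subseteq> range e" "U.independent B" "range e \<subseteq> U.span B"
    using U.maximal_independent_subset by blast
  obtain L where L: "Vector_Spaces.linear fscale sW L" "\<forall>t\<in>B. L t = F (SOME p. t = e p)"
    using UW.linear_independent_extend[OF B(2), of "\<lambda>t. F (SOME p. t = e p)"] by blast
  have "L (e p) = F p" for p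
  proof (rule ccontr)
    assume "L (e p) \<noteq> F p"
    hence "W.independent {L (e p) - F p}" by simp
    then obtain f where f: "Vector_Spaces.linear sW (*) f" "f (L (e p) - F p) = 1"
      using WK.linear_independent_extend[of _ "\<lambda>_. 1"] by blast
    obtain \<beta> where \<beta>: "\<forall>p. f (F p) = e p \<beta>" using sep[OF f(1)] by blast
    have l1: "Vector_Spaces.linear fscale (*) (\<lambda>\<xi>. f (L \<xi>))"
      using L(1) f(1) unfolding Vector_Spaces.linear_iff by simp
    have l2: "Vector_Spaces.linear fscale (*) (\<lambda>\<xi>. \<xi> \<beta>)"
      unfolding Vector_Spaces.linear_iff
      by (simp add: vector_space_fscale vector_space_field fscale_def)
    have "f (L t) = t \<beta>" if "t \<in> B" for t
    proof -
      have "t = e (SOME p. t = e p)" using that B(1) by (metis (mono_tags, lifting) rangeE someI subsetD)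
      thus ?thesis using L(2) that \<beta> by metis
    qed
    hence "f (L (e p)) = e p \<beta>"
      using UK.linear_eq_on[OF l1 l2, of "e p" B] B(3) by blast
    hence "f (L (e p)) = f (F p)" using \<beta> by simp
    moreover have "f (L (e p) - F p) = f (L (e p)) - f (F p)"
      using WK.linear_diff[OF f(1)] by blast
    ultimately show False using f(2) by simp
  qed
  thus ?thesis using L(1) by blast
qed

theorem tensor2_universal:
  fixes sA :: "'k::field \<Rightarrow> 'a::ab_group_add \<Rightarrow> 'a"
  assumes "vector_space sW" "bilinear_map sA sB sW F"
  shows "\<exists>L. Vector_Spaces.linear fscale sW L \<and> (\<forall>a b. L (tens sA sB a b) = F a b)"
proof -
  have "\<exists>L. Vector_Spaces.linear fscale sW L \<and>
      (\<forall>p. L (tens sA sB (fst p) (snd p)) = F (fst p) (snd p))"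
  proof (rule evaluation_lift[OF assms(1)])
    fix f assume "Vector_Spaces.linear sW (*) f"
    from bilinear_map_compose[OF assms(2) this]
    show "\<exists>\<beta>. \<forall>p. f (F (fst p) (snd p)) = tens sA sB (fst p) (snd p) \<beta>"
      by (auto simp: tens_def intro!: exI[of _ "\<lambda>a b. f (F a b)"])
  qed
  thus ?thesis by force
qed

theorem tensor3_universal:
  fixes sA :: "'k::field \<Rightarrow> 'a::ab_group_add \<Rightarrow> 'a"
  assumes "vector_space sW" "trilinear_map sA sB sC sW F"
  shows "\<exists>L. Vector_Spaces.linear fscale sW L \<and> (\<forall>a b c. L (tens3 sA sB sC a b c) = F a b c)"
proof -
  have "\<exists>L. Vector_Spaces.linear fscale sW L \<and>
      (\<forall>p. L (tens3 sA sB sC (fst p) (fst (snd p)) (snd (snd p))) = F (fst p) (fst (snd p)) (snd (snd p)))"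
  proof (rule evaluation_lift[OF assms(1)])
    fix f assume "Vector_Spaces.linear sW (*) f"
    from trilinear_map_compose[OF assms(2) this]
    show "\<exists>\<beta>. \<forall>p. f (F (fst p) (fst (snd p)) (snd (snd p))) =
        tens3 sA sB sC (fst p) (fst (snd p)) (snd (snd p)) \<beta>"
      by (auto simp: tens3_def intro!: exI[of _ "\<lambda>a b c. f (F a b c)"])
  qed
  thus ?thesis by force
qed

definition linear_to_tensors ::
  "('k::field \<Rightarrow> 'u::ab_group_add \<Rightarrow> 'u) \<Rightarrow> ('k \<Rightarrow> 'a::ab_group_add \<Rightarrow> 'a) \<Rightarrow>
   ('k \<Rightarrow> 'b::ab_group_add \<Rightarrow> 'b) \<Rightarrow> ('u \<Rightarrow> ('a, 'b, 'k) tensor2) \<Rightarrow> bool" where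
  "linear_to_tensors sU sA sB D \<longleftrightarrow>
     Vector_Spaces.linear sU fscale D \<and> range D \<subseteq> tensor_space sA sB"

section \<open>Anti-flexible algebras, coalgebras and bialgebras\<close>

definition antiflexible_algebra ::
  "('k::field \<Rightarrow> 'a::ab_group_add \<Rightarrow> 'a) \<Rightarrow> ('a \<Rightarrow> 'a \<Rightarrow> 'a) \<Rightarrow> bool" where
  "antiflexible_algebra s m \<longleftrightarrow>
     bilinear_map s s s m \<and>
     (\<forall>a b c. m (m a b) c - m a (m b c) = m (m c b) a - m c (m b a))"

text \<open>\<open>T = (\<Delta> \<otimes> id) \<Delta> - (id \<otimes> \<Delta>) \<Delta>\<close>\<close>

definition coassociator ::
  "('k::field \<Rightarrow> 'a::ab_group_add \<Rightarrow> 'a) \<Rightarrow> ('a \<Rightarrow> ('a, 'a, 'k) tensor2) \<Rightarrow>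
   'a \<Rightarrow> ('a, 'a, 'a, 'k) tensor3" where
  "coassociator s D a =
     sweedler (D a) (\<lambda>a1 a2. sweedler (D a1) (\<lambda>a11 a12. tens3 s s s a11 a12 a2)) -
     sweedler (D a) (\<lambda>a1 a2. sweedler (D a2) (\<lambda>a21 a22. tens3 s s s a1 a21 a22))"

definition antiflexible_coalgebra ::
  "('k::field \<Rightarrow> 'a::ab_group_add \<Rightarrow> 'a) \<Rightarrow> ('a \<Rightarrow> ('a, 'a, 'k) tensor2) \<Rightarrow> bool" where
  "antiflexible_coalgebra s D \<longleftrightarrow>
     linear_to_tensors s s s D \<and>
     (\<forall>a. coassociator s D a = tau13 (coassociator s D a))"

definition antiflexible_bialgebra ::
  "('k::field \<Rightarrow> 'a::ab_group_add \<Rightarrow> 'a) \<Rightarrow> ('a \<Rightarrow> 'a \<Rightarrow> 'a) \<Rightarrow>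
   ('a \<Rightarrow> ('a, 'a, 'k) tensor2) \<Rightarrow> bool" where
  "antiflexible_bialgebra s m D \<longleftrightarrow>
     antiflexible_algebra s m \<and> antiflexible_coalgebra s D \<and>
     (\<forall>a b. D (m a b) + tau (D (m b a)) =
          sweedler (D a) (\<lambda>a1 a2. tens s s (m a1 b) a2)
        + sweedler (D a) (\<lambda>a1 a2. tens s s (m b a2) a1)
        + sweedler (D b) (\<lambda>b1 b2. tens s s b1 (m a b2))
        + sweedler (D b) (\<lambda>b1 b2. tens s s b2 (m b1 a))) \<and>
     (\<forall>a b. id_minus_tau
         (sweedler (D a) (\<lambda>a1 a2. tens s s a1 (m a2 b))
        + sweedler (D b) (\<lambda>b1 b2. tens s s (m a b1) b2)
        - sweedler (D a) (\<lambda>a1 a2. tens s s (m b a1) a2)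
        - sweedler (D b) (\<lambda>b1 b2. tens s s b1 (m b2 a))) = 0)"

definition algebra_hom ::
  "('k::field \<Rightarrow> 'a::ab_group_add \<Rightarrow> 'a) \<Rightarrow> ('a \<Rightarrow> 'a \<Rightarrow> 'a) \<Rightarrow>
   ('k \<Rightarrow> 'b::ab_group_add \<Rightarrow> 'b) \<Rightarrow> ('b \<Rightarrow> 'b \<Rightarrow> 'b) \<Rightarrow> ('a \<Rightarrow> 'b) \<Rightarrow> bool" where
  "algebra_hom s m s' m' f \<longleftrightarrow>
     Vector_Spaces.linear s s' f \<and> (\<forall>a b. f (m a b) = m' (f a) (f b))"

definition coalgebra_hom ::
  "('k::field \<Rightarrow> 'a::ab_group_add \<Rightarrow> 'a) \<Rightarrow> ('a \<Rightarrow> ('a, 'a, 'k) tensor2) \<Rightarrow>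
   ('k \<Rightarrow> 'b::ab_group_add \<Rightarrow> 'b) \<Rightarrow> ('b \<Rightarrow> ('b, 'b, 'k) tensor2) \<Rightarrow> ('a \<Rightarrow> 'b) \<Rightarrow> bool" where
  "coalgebra_hom s D s' D' f \<longleftrightarrow>
     Vector_Spaces.linear s s' f \<and>
     (\<forall>a. sweedler (D a) (\<lambda>a1 a2. tens s' s' (f a1) (f a2)) = D' (f a))"

text \<open>
  \<open>E\<close> contains \<open>A\<close> as a subspace with complement \<open>V\<close>.  The inclusions of the two subspaces are the
  injective linear maps \<open>iA\<close> and \<open>iV\<close>.
\<close>

definition complemented_inclusion ::
  "('k::field \<Rightarrow> 'a::ab_group_add \<Rightarrow> 'a) \<Rightarrow> ('k \<Rightarrow> 'v::ab_group_add \<Rightarrow> 'v) \<Rightarrow>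
   ('k \<Rightarrow> 'e::ab_group_add \<Rightarrow> 'e) \<Rightarrow> ('a \<Rightarrow> 'e) \<Rightarrow> ('v \<Rightarrow> 'e) \<Rightarrow> bool" where
  "complemented_inclusion sA sV sE iA iV \<longleftrightarrow>
     Vector_Spaces.linear sA sE iA \<and> inj iA \<and>
     Vector_Spaces.linear sV sE iV \<and> inj iV \<and>
     range iA \<inter> range iV = {0} \<and> (\<forall>e. \<exists>a x. e = iA a + iV x)"

section \<open>Extending data of type (I) and the unified biproduct\<close>

text \<open>
  In the formulas below \<open>u, u1, u2\<close> are tensor legs in \<open>A\<close> and \<open>v, v1, v2\<close> are tensor legs in \<open>V\<close>.
  For instance \<open>sweedler (\<phi> a) (\<lambda>v u. F v u)\<close> has \<open>v\<close>, \<open>u\<close> for the components of \<open>\<phi> a\<close> with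
  indices \<open>(-1)\<close>, \<open>(0)\<close>, and \<open>sweedler (\<gamma> x) (\<lambda>v u. F v u)\<close> has them for those of \<open>\<gamma> x\<close> with
  indices \<open>[0]\<close>, \<open>[1]\<close>.
\<close>

locale extending_datum = A: vector_space sA + V: vector_space sV
  for sA :: "'k::field_char_0 \<Rightarrow> 'a::ab_group_add \<Rightarrow> 'a"
    and sV :: "'k \<Rightarrow> 'v::ab_group_add \<Rightarrow> 'v" +
  fixes mA :: "'a \<Rightarrow> 'a \<Rightarrow> 'a"  (infixl "\<cdot>\<^sub>A" 75)
    and \<Delta>\<^sub>A :: "'a \<Rightarrow> ('a, 'a, 'k) tensor2"
    and lact :: "'a \<Rightarrow> 'v \<Rightarrow> 'v"  (infixl "\<triangleright>" 75)
    and ract :: "'v \<Rightarrow> 'a \<Rightarrow> 'v"  (infixl "\<triangleleft>" 75)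
    and \<theta> :: "'a \<Rightarrow> 'a \<Rightarrow> 'v"
    and P :: "'a \<Rightarrow> ('v, 'v, 'k) tensor2"
    and mV :: "'v \<Rightarrow> 'v \<Rightarrow> 'v"  (infixl "\<cdot>\<^sub>V" 75)
    and \<phi> :: "'a \<Rightarrow> ('v, 'a, 'k) tensor2"
    and \<psi> :: "'a \<Rightarrow> ('a, 'v, 'k) tensor2"
    and \<rho> :: "'v \<Rightarrow> ('a, 'v, 'k) tensor2"
    and \<gamma> :: "'v \<Rightarrow> ('v, 'a, 'k) tensor2"
    and \<Delta>\<^sub>V :: "'v \<Rightarrow> ('v, 'v, 'k) tensor2"
  assumes bialgebra_A: "antiflexible_bialgebra sA mA \<Delta>\<^sub>A"
    and bilinear_lact: "bilinear_map sA sV sV lact"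
    and bilinear_ract: "bilinear_map sV sA sV ract"
    and bilinear_theta: "bilinear_map sA sA sV \<theta>"
    and linear_P: "linear_to_tensors sA sV sV P"
    and bilinear_mV: "bilinear_map sV sV sV mV"
    and linear_phi: "linear_to_tensors sA sV sA \<phi>"
    and linear_psi: "linear_to_tensors sA sA sV \<psi>"
    and linear_rho: "linear_to_tensors sV sA sV \<rho>"
    and linear_gamma: "linear_to_tensors sV sV sA \<gamma>"
    and linear_DeltaV: "linear_to_tensors sV sV sV \<Delta>\<^sub>V"
begin

abbreviation tensAA (infix "\<otimes>\<^sub>A\<^sub>A" 70) where "tensAA \<equiv> tens sA sA"
abbreviation tensAV (infix "\<otimes>\<^sub>A\<^sub>V" 70) where "tensAV \<equiv> tens sA sV"
abbreviation tensVA (infix "\<otimes>\<^sub>V\<^sub>A" 70) where "tensVA \<equiv> tens sV sA"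
abbreviation tensVV (infix "\<otimes>\<^sub>V\<^sub>V" 70) where "tensVV \<equiv> tens sV sV"

abbreviation scaleE :: "'k \<Rightarrow> 'a \<times> 'v \<Rightarrow> 'a \<times> 'v" where
  "scaleE \<equiv> module_prod.scale sA sV"

abbreviation tensEE (infix "\<otimes>\<^sub>E" 70) where "tensEE \<equiv> tens scaleE scaleE"

fun mult_E :: "'a \<times> 'v \<Rightarrow> 'a \<times> 'v \<Rightarrow> 'a \<times> 'v" where
  "mult_E (a, x) (b, y) = (a \<cdot>\<^sub>A b, x \<cdot>\<^sub>V y + a \<triangleright> y + x \<triangleleft> b + \<theta> a b)"

fun Delta_E :: "'a \<times> 'v \<Rightarrow> ('a \<times> 'v, 'a \<times> 'v, 'k) tensor2" where
  "Delta_E (a, x) =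
     sweedler (\<Delta>\<^sub>A a) (\<lambda>u1 u2. (u1, 0) \<otimes>\<^sub>E (u2, 0)) + sweedler (\<phi> a) (\<lambda>v u. (0, v) \<otimes>\<^sub>E (u, 0))
   + sweedler (\<psi> a) (\<lambda>u v. (u, 0) \<otimes>\<^sub>E (0, v)) + sweedler (P a) (\<lambda>v1 v2. (0, v1) \<otimes>\<^sub>E (0, v2))
   + sweedler (\<Delta>\<^sub>V x) (\<lambda>v1 v2. (0, v1) \<otimes>\<^sub>E (0, v2)) + sweedler (\<rho> x) (\<lambda>u v. (u, 0) \<otimes>\<^sub>E (0, v))
   + sweedler (\<gamma> x) (\<lambda>v u. (0, v) \<otimes>\<^sub>E (u, 0))"

definition E1 :: bool where
  "E1 \<longleftrightarrow> (\<forall>a b.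
     \<phi> (a \<cdot>\<^sub>A b) + tau (\<psi> (b \<cdot>\<^sub>A a)) + \<gamma> (\<theta> a b) + tau (\<rho> (\<theta> b a)) =
       sweedler (\<Delta>\<^sub>A a) (\<lambda>u1 u2. \<theta> b u2 \<otimes>\<^sub>V\<^sub>A u1)
     + sweedler (\<psi> a) (\<lambda>u v. b \<triangleright> v \<otimes>\<^sub>V\<^sub>A u)
     + sweedler (\<psi> b) (\<lambda>u v. v \<otimes>\<^sub>V\<^sub>A u \<cdot>\<^sub>A a)
     + sweedler (\<Delta>\<^sub>A a) (\<lambda>u1 u2. \<theta> u1 b \<otimes>\<^sub>V\<^sub>A u2)
     + sweedler (\<phi> a) (\<lambda>v u. v \<triangleleft> b \<otimes>\<^sub>V\<^sub>A u)
     + sweedler (\<phi> b) (\<lambda>v u. v \<otimes>\<^sub>V\<^sub>A a \<cdot>\<^sub>A u))"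

definition E2 :: bool where
  "E2 \<longleftrightarrow> (\<forall>x y.
     \<rho> (x \<cdot>\<^sub>V y) + tau (\<gamma> (y \<cdot>\<^sub>V x)) =
       sweedler (\<gamma> y) (\<lambda>v u. u \<otimes>\<^sub>A\<^sub>V v \<cdot>\<^sub>V x)
     + sweedler (\<rho> y) (\<lambda>u v. u \<otimes>\<^sub>A\<^sub>V x \<cdot>\<^sub>V v))"

definition E3 :: bool where
  "E3 \<longleftrightarrow> (\<forall>a y.
     \<Delta>\<^sub>V (a \<triangleright> y) + tau (\<Delta>\<^sub>V (y \<triangleleft> a)) =
       sweedler (\<phi> a) (\<lambda>v u. y \<triangleleft> u \<otimes>\<^sub>V\<^sub>V v)
     + sweedler (P a) (\<lambda>v1 v2. y \<cdot>\<^sub>V v2 \<otimes>\<^sub>V\<^sub>V v1)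
     + sweedler (\<Delta>\<^sub>V y) (\<lambda>v1 v2. v2 \<otimes>\<^sub>V\<^sub>V v1 \<triangleleft> a)
     + sweedler (\<rho> y) (\<lambda>u v. v \<otimes>\<^sub>V\<^sub>V \<theta> u a)
     + sweedler (\<psi> a) (\<lambda>u v. u \<triangleright> y \<otimes>\<^sub>V\<^sub>V v)
     + sweedler (P a) (\<lambda>v1 v2. v1 \<cdot>\<^sub>V y \<otimes>\<^sub>V\<^sub>V v2)
     + sweedler (\<Delta>\<^sub>V y) (\<lambda>v1 v2. v1 \<otimes>\<^sub>V\<^sub>V a \<triangleright> v2)
     + sweedler (\<gamma> y) (\<lambda>v u. v \<otimes>\<^sub>V\<^sub>V \<theta> a u))"

definition E4 :: bool where
  "E4 \<longleftrightarrow> (\<forall>a b.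
     \<Delta>\<^sub>V (\<theta> a b) + tau (\<Delta>\<^sub>V (\<theta> b a)) + P (a \<cdot>\<^sub>A b) + tau (P (b \<cdot>\<^sub>A a)) =
       sweedler (\<phi> a) (\<lambda>v u. \<theta> b u \<otimes>\<^sub>V\<^sub>V v)
     + sweedler (P a) (\<lambda>v1 v2. b \<triangleright> v2 \<otimes>\<^sub>V\<^sub>V v1)
     + sweedler (\<psi> b) (\<lambda>u v. v \<otimes>\<^sub>V\<^sub>V \<theta> u a)
     + sweedler (P b) (\<lambda>v1 v2. v2 \<otimes>\<^sub>V\<^sub>V v1 \<triangleleft> a)
     + sweedler (\<psi> a) (\<lambda>u v. \<theta> u b \<otimes>\<^sub>V\<^sub>V v)
     + sweedler (P a) (\<lambda>v1 v2. v1 \<triangleleft> b \<otimes>\<^sub>V\<^sub>V v2)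
     + sweedler (\<phi> b) (\<lambda>v u. v \<otimes>\<^sub>V\<^sub>V \<theta> a u)
     + sweedler (P b) (\<lambda>v1 v2. v1 \<otimes>\<^sub>V\<^sub>V a \<triangleright> v2))"

definition E5 :: bool where
  "E5 \<longleftrightarrow> (\<forall>x b.
     \<gamma> (x \<triangleleft> b) + tau (\<rho> (b \<triangleright> x)) =
       sweedler (\<rho> x) (\<lambda>u v. b \<triangleright> v \<otimes>\<^sub>V\<^sub>A u)
     + sweedler (\<gamma> x) (\<lambda>v u. v \<triangleleft> b \<otimes>\<^sub>V\<^sub>A u))"

definition E6 :: bool where
  "E6 \<longleftrightarrow> (\<forall>x b.
     \<rho> (x \<triangleleft> b) + tau (\<gamma> (b \<triangleright> x)) =
       sweedler (\<gamma> x) (\<lambda>v u. b \<cdot>\<^sub>A u \<otimes>\<^sub>A\<^sub>V v)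
     + sweedler (\<Delta>\<^sub>A b) (\<lambda>u1 u2. u2 \<otimes>\<^sub>A\<^sub>V u1 \<triangleright> x)
     + sweedler (\<phi> b) (\<lambda>v u. u \<otimes>\<^sub>A\<^sub>V v \<cdot>\<^sub>V x)
     + sweedler (\<rho> x) (\<lambda>u v. u \<cdot>\<^sub>A b \<otimes>\<^sub>A\<^sub>V v)
     + sweedler (\<Delta>\<^sub>A b) (\<lambda>u1 u2. u1 \<otimes>\<^sub>A\<^sub>V x \<triangleleft> u2)
     + sweedler (\<psi> b) (\<lambda>u v. u \<otimes>\<^sub>A\<^sub>V x \<cdot>\<^sub>V v))"

definition E7 :: bool where
  "E7 \<longleftrightarrow> (\<forall>a b.
       sweedler (\<Delta>\<^sub>A a) (\<lambda>u1 u2. u1 \<otimes>\<^sub>A\<^sub>V \<theta> u2 b)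
     + sweedler (\<psi> a) (\<lambda>u v. u \<otimes>\<^sub>A\<^sub>V v \<triangleleft> b)
     + sweedler (\<psi> b) (\<lambda>u v. a \<cdot>\<^sub>A u \<otimes>\<^sub>A\<^sub>V v)
     - sweedler (\<Delta>\<^sub>A b) (\<lambda>u1 u2. u1 \<otimes>\<^sub>A\<^sub>V \<theta> u2 a)
     - sweedler (\<psi> b) (\<lambda>u v. u \<otimes>\<^sub>A\<^sub>V v \<triangleleft> a)
     - sweedler (\<psi> a) (\<lambda>u v. b \<cdot>\<^sub>A u \<otimes>\<^sub>A\<^sub>V v) =
     tau (
       sweedler (\<phi> a) (\<lambda>v u. v \<otimes>\<^sub>V\<^sub>A u \<cdot>\<^sub>A b)
     + sweedler (\<Delta>\<^sub>A b) (\<lambda>u1 u2. \<theta> a u1 \<otimes>\<^sub>V\<^sub>A u2)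
     + sweedler (\<phi> b) (\<lambda>v u. a \<triangleright> v \<otimes>\<^sub>V\<^sub>A u)
     - sweedler (\<phi> b) (\<lambda>v u. v \<otimes>\<^sub>V\<^sub>A u \<cdot>\<^sub>A a)
     - sweedler (\<Delta>\<^sub>A a) (\<lambda>u1 u2. \<theta> b u1 \<otimes>\<^sub>V\<^sub>A u2)
     - sweedler (\<phi> a) (\<lambda>v u. b \<triangleright> v \<otimes>\<^sub>V\<^sub>A u)))"

definition E8 :: bool where
  "E8 \<longleftrightarrow> (\<forall>a b.
     id_minus_tau (
       sweedler (\<phi> a) (\<lambda>v u. v \<otimes>\<^sub>V\<^sub>V \<theta> u b)
     + sweedler (P a) (\<lambda>v1 v2. v1 \<otimes>\<^sub>V\<^sub>V v2 \<triangleleft> b)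
     + sweedler (\<psi> b) (\<lambda>u v. \<theta> a u \<otimes>\<^sub>V\<^sub>V v)
     + sweedler (P b) (\<lambda>v1 v2. a \<triangleright> v1 \<otimes>\<^sub>V\<^sub>V v2)) =
     id_minus_tau (
       sweedler (\<phi> b) (\<lambda>v u. v \<otimes>\<^sub>V\<^sub>V \<theta> u a)
     + sweedler (P b) (\<lambda>v1 v2. v1 \<otimes>\<^sub>V\<^sub>V v2 \<triangleleft> a)
     + sweedler (\<psi> a) (\<lambda>u v. \<theta> b u \<otimes>\<^sub>V\<^sub>V v)
     + sweedler (P a) (\<lambda>v1 v2. b \<triangleright> v1 \<otimes>\<^sub>V\<^sub>V v2)))"

definition E9 :: bool where
  "E9 \<longleftrightarrow> (\<forall>x b.
       sweedler (\<gamma> x) (\<lambda>v u. v \<otimes>\<^sub>V\<^sub>A u \<cdot>\<^sub>A b)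
     + sweedler (\<Delta>\<^sub>A b) (\<lambda>u1 u2. x \<triangleleft> u1 \<otimes>\<^sub>V\<^sub>A u2)
     + sweedler (\<phi> b) (\<lambda>v u. x \<cdot>\<^sub>V v \<otimes>\<^sub>V\<^sub>A u)
     - sweedler (\<gamma> x) (\<lambda>v u. b \<triangleright> v \<otimes>\<^sub>V\<^sub>A u) =
     tau (
       sweedler (\<rho> x) (\<lambda>u v. u \<otimes>\<^sub>A\<^sub>V v \<triangleleft> b)
     - sweedler (\<Delta>\<^sub>A b) (\<lambda>u1 u2. u1 \<otimes>\<^sub>A\<^sub>V u2 \<triangleright> x)
     - sweedler (\<psi> b) (\<lambda>u v. u \<otimes>\<^sub>A\<^sub>V v \<cdot>\<^sub>V x)
     - sweedler (\<rho> x) (\<lambda>u v. b \<cdot>\<^sub>A u \<otimes>\<^sub>A\<^sub>V v)))"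

definition E10 :: bool where
  "E10 \<longleftrightarrow> (\<forall>x b.
     id_minus_tau (
       sweedler (\<Delta>\<^sub>V x) (\<lambda>v1 v2. v1 \<otimes>\<^sub>V\<^sub>V v2 \<triangleleft> b)
     + sweedler (\<gamma> x) (\<lambda>v u. v \<otimes>\<^sub>V\<^sub>V \<theta> u b)
     + sweedler (\<psi> b) (\<lambda>u v. x \<triangleleft> u \<otimes>\<^sub>V\<^sub>V v)
     + sweedler (P b) (\<lambda>v1 v2. x \<cdot>\<^sub>V v1 \<otimes>\<^sub>V\<^sub>V v2)) =
     id_minus_tau (
       sweedler (\<phi> b) (\<lambda>v u. v \<otimes>\<^sub>V\<^sub>V u \<triangleright> x)
     + sweedler (P b) (\<lambda>v1 v2. v1 \<otimes>\<^sub>V\<^sub>V v2 \<cdot>\<^sub>V x)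
     + sweedler (\<Delta>\<^sub>V x) (\<lambda>v1 v2. b \<triangleright> v1 \<otimes>\<^sub>V\<^sub>V v2)
     + sweedler (\<rho> x) (\<lambda>u v. \<theta> b u \<otimes>\<^sub>V\<^sub>V v)))"

definition E12 :: bool where
  "E12 \<longleftrightarrow> (\<forall>x y.
       sweedler (\<gamma> y) (\<lambda>v u. x \<cdot>\<^sub>V v \<otimes>\<^sub>V\<^sub>A u)
     - sweedler (\<gamma> x) (\<lambda>v u. y \<cdot>\<^sub>V v \<otimes>\<^sub>V\<^sub>A u) =
     tau (
       sweedler (\<rho> x) (\<lambda>u v. u \<otimes>\<^sub>A\<^sub>V v \<cdot>\<^sub>V y)
     - sweedler (\<rho> y) (\<lambda>u v. u \<otimes>\<^sub>A\<^sub>V v \<cdot>\<^sub>V x)))"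

definition E13 :: bool where
  "E13 \<longleftrightarrow> (\<forall>x y.
     \<Delta>\<^sub>V (x \<cdot>\<^sub>V y) + tau (\<Delta>\<^sub>V (y \<cdot>\<^sub>V x)) =
       sweedler (\<Delta>\<^sub>V x) (\<lambda>v1 v2. y \<cdot>\<^sub>V v2 \<otimes>\<^sub>V\<^sub>V v1)
     + sweedler (\<Delta>\<^sub>V y) (\<lambda>v1 v2. v2 \<otimes>\<^sub>V\<^sub>V v1 \<cdot>\<^sub>V x)
     + sweedler (\<Delta>\<^sub>V x) (\<lambda>v1 v2. v1 \<cdot>\<^sub>V y \<otimes>\<^sub>V\<^sub>V v2)
     + sweedler (\<Delta>\<^sub>V y) (\<lambda>v1 v2. v1 \<otimes>\<^sub>V\<^sub>V x \<cdot>\<^sub>V v2)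
     + sweedler (\<gamma> x) (\<lambda>v u. y \<triangleleft> u \<otimes>\<^sub>V\<^sub>V v)
     + sweedler (\<rho> y) (\<lambda>u v. v \<otimes>\<^sub>V\<^sub>V u \<triangleright> x)
     + sweedler (\<rho> x) (\<lambda>u v. u \<triangleright> y \<otimes>\<^sub>V\<^sub>V v)
     + sweedler (\<gamma> y) (\<lambda>v u. v \<otimes>\<^sub>V\<^sub>V x \<triangleleft> u))"

definition E14 :: bool where
  "E14 \<longleftrightarrow> (\<forall>x y.
     id_minus_tau (
       sweedler (\<Delta>\<^sub>V x) (\<lambda>v1 v2. v1 \<otimes>\<^sub>V\<^sub>V v2 \<cdot>\<^sub>V y)
     + sweedler (\<Delta>\<^sub>V y) (\<lambda>v1 v2. x \<cdot>\<^sub>V v1 \<otimes>\<^sub>V\<^sub>V v2)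
     - sweedler (\<Delta>\<^sub>V y) (\<lambda>v1 v2. v1 \<otimes>\<^sub>V\<^sub>V v2 \<cdot>\<^sub>V x)
     - sweedler (\<Delta>\<^sub>V x) (\<lambda>v1 v2. y \<cdot>\<^sub>V v1 \<otimes>\<^sub>V\<^sub>V v2)) +
     id_minus_tau (
       sweedler (\<gamma> x) (\<lambda>v u. v \<otimes>\<^sub>V\<^sub>V u \<triangleright> y)
     + sweedler (\<rho> y) (\<lambda>u v. x \<triangleleft> u \<otimes>\<^sub>V\<^sub>V v)
     - sweedler (\<gamma> y) (\<lambda>v u. v \<otimes>\<^sub>V\<^sub>V u \<triangleright> x)
     - sweedler (\<rho> x) (\<lambda>u v. y \<triangleleft> u \<otimes>\<^sub>V\<^sub>V v)) = 0)"

definition biproduct_conditions :: bool where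
  "biproduct_conditions \<longleftrightarrow>
     antiflexible_algebra scaleE mult_E \<and> antiflexible_coalgebra scaleE Delta_E \<and>
     E1 \<and> E2 \<and> E3 \<and> E4 \<and> E5 \<and> E6 \<and> E7 \<and> E8 \<and> E9 \<and> E10 \<and> E12 \<and> E13 \<and> E14"

end

end

theory Submission
  imports Defs
begin

text \<open>
  A tensor is determined by its values on bilinear forms, so both compatibility axioms of a bialgebra
  become the vanishing of a scalar, called defect below, that depends additively on the two
  elements and on the form.  On \<open>A \<oplus> V\<close> every element is a sum of one in \<open>A\<close> and one in \<open>V\<close>, and
  every form is a sum of four blocks.  For pure elements and a single block the vanishing of the defect
  is one of the conditions (E1)--(E14), an axiom of \<open>A\<close>, or trivial; the remaining cases follow from
  the symmetry of the defects under exchanging the two elements and under \<open>\<tau>\<close>.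

  Conversely, the bialgebra structure of \<open>E\<close> is pulled back to \<open>A \<times> V\<close>, and its blocks are the
  extending datum.  Since \<open>p\<close> is a homomorphism, products have the \<open>A\<close>-component prescribed
  by \<open>A\<close>, and \<open>\<Delta>\<close> has the \<open>A \<otimes> A\<close>-block \<open>\<Delta>\<^sub>A\<close> on \<open>A\<close> and \<open>0\<close> on \<open>V\<close>.
\<close>

section \<open>Tensors as functionals on bilinear forms\<close>

lemma bilinear_map_iff:
  assumes "vector_space sA" "vector_space sB" "vector_space sC"
  shows "bilinear_map sA sB sC F \<longleftrightarrow>
    (\<forall>a a' b. F (a + a') b = F a b + F a' b) \<and> (\<forall>a b b'. F a (b + b') = F a b + F a b') \<and>
    (\<forall>c a b. F (sA c a) b = sC c (F a b)) \<and> (\<forall>c a b. F a (sB c b) = sC c (F a b))"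
  using assms unfolding bilinear_map_def Vector_Spaces.linear_iff by blast

lemma bilinear_map_swap: "bilinear_map sA sB sC F \<Longrightarrow> bilinear_map sB sA sC (\<lambda>u v. F v u)"
  unfolding bilinear_map_def by blast

lemma bilinear_map_swap_iff: "bilinear_map sA sB sC (\<lambda>u v. F v u) \<longleftrightarrow> bilinear_map sB sA sC F"
  unfolding bilinear_map_def by blast

lemma bilinear_map_precompose:
  assumes "bilinear_map sA sB sC F" "Vector_Spaces.linear sA' sA f" "Vector_Spaces.linear sB' sB g"
  shows "bilinear_map sA' sB' sC (\<lambda>u v. F (f u) (g v))"
  using assms unfolding bilinear_map_def Vector_Spaces.linear_iff by simp

lemma bilinear_map_add:
  assumes "bilinear_map sA sB sC F" "bilinear_map sA sB sC G"
  shows "bilinear_map sA sB sC (\<lambda>u v. F u v + G u v)"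
  using assms unfolding bilinear_map_def
  unfolding Vector_Spaces.linear_iff by (simp add: vector_space.vector_space_assms(1) algebra_simps)

lemma bilinear_map_zeroL:
  assumes "bilinear_map sA sB sC F" shows "F 0 b = 0"
proof -
  have "F (0 + 0) b = F 0 b + F 0 b"
    using assms unfolding bilinear_map_def Vector_Spaces.linear_iff by blast
  then show ?thesis by simp
qed

lemma bilinear_map_zeroR:
  assumes "bilinear_map sA sB sC F" shows "F a 0 = 0"
proof -
  have "F a (0 + 0) = F a 0 + F a 0"
    using assms unfolding bilinear_map_def Vector_Spaces.linear_iff by blast
  then show ?thesis by simp
qed

lemma tens_apply: "bilinear_map sA sB (*) \<beta> \<Longrightarrow> tens sA sB a b \<beta> = \<beta> a b"
  by (simp add: tens_def)

lemma tens_apply_not_bilinear: "\<not> bilinear_map sA sB (*) \<beta> \<Longrightarrow> tens sA sB a b \<beta> = 0"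
  by (simp add: tens_def)

lemma sweedler_apply: "sweedler \<xi> F \<beta> = \<xi> (\<lambda>u v. F u v \<beta>)"
  by (simp add: sweedler_def)

lemma tau_apply: "tau \<xi> \<beta> = \<xi> (\<lambda>u v. \<beta> v u)"
  by (simp add: tau_def)

section \<open>Tensors as functions of the form\<close>

lemma tensor_space_induct [consumes 1, case_names zero add]:
  assumes "\<xi> \<in> tensor_space sA sB"
    and "Q 0"
    and "\<And>c a b \<xi>. Q \<xi> \<Longrightarrow> Q (fscale c (tens sA sB a b) + \<xi>)"
  shows "Q \<xi>"
proof -
  interpret vector_space "fscale :: 'c \<Rightarrow> ('a, 'b, 'c) tensor2 \<Rightarrow> _" by (rule vector_space_fscale)
  show ?thesis
    using assms(1) unfolding tensor_space_def
    by (induction rule: span_induct_alt) (use assms(2,3) in blast)+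
qed

text \<open>A tensor is a priori an arbitrary function on maps of two arguments. On bilinear maps it
  is additive because pure tensors act there by evaluation, and this passes to linear
  combinations.\<close>

lemma tensor_add:
  assumes "\<xi> \<in> tensor_space sA sB" "bilinear_map sA sB (*) \<beta>" "bilinear_map sA sB (*) \<beta>'"
  shows "\<xi> (\<lambda>u v. \<beta> u v + \<beta>' u v) = \<xi> \<beta> + \<xi> \<beta>'"
  using assms(1)
  by (induction rule: tensor_space_induct)
    (simp_all add: tens_apply assms(2,3) bilinear_map_add fscale_def algebra_simps)

lemma tensor_scale:
  assumes "\<xi> \<in> tensor_space sA sB" "bilinear_map sA sB (*) \<beta>"
  shows "\<xi> (\<lambda>u v. c * \<beta> u v) = c * \<xi> \<beta>"
proof -
  have "Vector_Spaces.linear (*) (*) ((*) c)"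
    using vector_space_field unfolding Vector_Spaces.linear_iff by (simp add: algebra_simps)
  then have "bilinear_map sA sB (*) (\<lambda>u v. c * \<beta> u v)"
    by (rule bilinear_map_compose[OF assms(2)])
  with assms(1) show ?thesis
    by (induction rule: tensor_space_induct)
      (simp_all add: tens_apply assms(2) fscale_def algebra_simps)
qed

lemma tensor_zero:
  assumes "\<xi> \<in> tensor_space sA sB"
  shows "\<xi> (\<lambda>u v. 0) = 0"
proof -
  \<comment> \<open>Both branches of \<open>tens\<close> give 0 at the zero form.\<close>
  have "tens sA sB a b (\<lambda>u v. 0) = 0" for a b by (simp add: tens_def)
  with assms show ?thesis
    by (induction rule: tensor_space_induct) (simp_all add: fscale_def)
qed

text \<open>The default value 0 of \<open>tens\<close> passes to the whole span. This settles the
  arguments that are not bilinear when an equality of tensors is tested pointwise.\<close>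

lemma tensor_not_bilinear:
  assumes "\<xi> \<in> tensor_space sA sB" "\<not> bilinear_map sA sB (*) \<beta>"
  shows "\<xi> \<beta> = 0"
  using assms(1)
  by (induction rule: tensor_space_induct) (simp_all add: fscale_def tens_apply_not_bilinear assms(2))

text \<open>\<open>sweedler\<close> is linear in the tensor and sends pure tensors to values of
  \<open>F\<close>, so induction over the span applies.\<close>

lemma sweedler_in_tensor_space:
  fixes F :: "'a::ab_group_add \<Rightarrow> 'b::ab_group_add \<Rightarrow> ('c::ab_group_add, 'd::ab_group_add, 'k::field) tensor2"
  assumes \<xi>: "\<xi> \<in> tensor_space sA sB" and F: "bilinear_map sA sB fscale F"
    and im: "\<And>a b. F a b \<in> tensor_space sC sD"
  shows "sweedler \<xi> F \<in> tensor_space sC sD"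
proof -
  interpret vector_space "fscale :: 'k \<Rightarrow> ('c, 'd, 'k) tensor2 \<Rightarrow> _" by (rule vector_space_fscale)
  show ?thesis
    using \<xi>
  proof (induction rule: tensor_space_induct)
    case zero
    have "sweedler 0 F = 0" by (simp add: sweedler_def fun_eq_iff)
    then show ?case unfolding tensor_space_def by (simp only: span_zero)
  next
    case (add c a b \<xi>)
    have "sweedler (fscale c (tens sA sB a b) + \<xi>) F = fscale c (F a b) + sweedler \<xi> F"
      using linear_sweedler[of F] unfolding Vector_Spaces.linear_iff by (simp add: sweedler_tens[OF F])
    then show ?case using add im unfolding tensor_space_def by (simp only: span_add span_scale)
  qed
qed

lemma tens_in_tensor_space: "tens sA sB a b \<in> tensor_space sA sB"
  unfolding tensor_space_def
  by (rule module.span_base) (use vector_space_fscale module_iff_vector_space in auto)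

section \<open>Linear maps into tensor spaces\<close>

lemma linear_to_tensors_mem: "linear_to_tensors sU sA sB D \<Longrightarrow> D a \<in> tensor_space sA sB"
  unfolding linear_to_tensors_def by blast

lemma linear_to_tensors_add: "linear_to_tensors sU sA sB D \<Longrightarrow> D (a + a') \<beta> = D a \<beta> + D a' \<beta>"
  unfolding linear_to_tensors_def Vector_Spaces.linear_iff by simp

lemma linear_to_tensors_scale: "linear_to_tensors sU sA sB D \<Longrightarrow> D (sU c a) \<beta> = c * D a \<beta>"
  unfolding linear_to_tensors_def Vector_Spaces.linear_iff fscale_def by simp

lemma linear_to_tensors_zero: "linear_to_tensors sU sA sB D \<Longrightarrow> D 0 \<beta> = 0"
  by (metis add_cancel_right_right linear_to_tensors_add)

text \<open>The map is \<open>D\<close> after \<open>i\<close>, followed by \<open>h\<close> and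
  \<open>k\<close> on the two legs. It serves both for the blocks of a comultiplication and for a
  comultiplication moved to another space.\<close>

lemma linear_to_tensors_map:
  assumes D: "linear_to_tensors sE sE sE D" and i: "Vector_Spaces.linear sU sE i"
    and h: "Vector_Spaces.linear sE sA h" and k: "Vector_Spaces.linear sE sB k"
  shows "linear_to_tensors sU sA sB (\<lambda>x. sweedler (D (i x)) (\<lambda>u v. tens sA sB (h u) (k v)))"
  unfolding linear_to_tensors_def
proof
  show "Vector_Spaces.linear sU fscale (\<lambda>x. sweedler (D (i x)) (\<lambda>u v. tens sA sB (h u) (k v)))"
    using D i linear_sweedler[of "\<lambda>u v. tens sA sB (h u) (k v)"]
    unfolding linear_to_tensors_def Vector_Spaces.linear_iff by simp
  have "vector_space sA" "vector_space sB"
    using h k unfolding Vector_Spaces.linear_iff by blast+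
  then have "bilinear_map sE sE fscale (\<lambda>u v. tens sA sB (h u) (k v))"
    by (intro bilinear_map_precompose[OF bilinear_map_tens h k])
  from sweedler_in_tensor_space[OF linear_to_tensors_mem[OF D] this tens_in_tensor_space]
  show "range (\<lambda>x. sweedler (D (i x)) (\<lambda>u v. tens sA sB (h u) (k v))) \<subseteq> tensor_space sA sB"
    by blast
qed

text \<open>Transposition is a bijection between the two classes of bilinear maps, so a quantifier
  over one can be reindexed by the other.\<close>

lemma all_bilinear_maps_swap:
  "(\<forall>\<beta>. bilinear_map sA sB sC \<beta> \<longrightarrow> Q \<beta>) \<longleftrightarrow> (\<forall>\<beta>. bilinear_map sB sA sC \<beta> \<longrightarrow> Q (\<lambda>u v. \<beta> v u))"
proof (intro iffI allI impI)
  fix \<beta> assume "\<forall>\<beta>. bilinear_map sB sA sC \<beta> \<longrightarrow> Q (\<lambda>u v. \<beta> v u)" and \<beta>: "bilinear_map sA sB sC \<beta>"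
  from this(1)[rule_format, OF bilinear_map_swap[OF \<beta>]] show "Q \<beta>" .
qed (simp add: bilinear_map_swap)

section \<open>The bialgebra axioms evaluated at forms\<close>

text \<open>Left minus right side of the first compatibility axiom, paired with a bilinear form;
  \<open>tau\<close> becomes an exchange of the arguments of the form.\<close>

definition first_defect ::
  "('a \<Rightarrow> 'a \<Rightarrow> 'a) \<Rightarrow> ('a \<Rightarrow> ('a, 'a, 'k::field) tensor2) \<Rightarrow> 'a \<Rightarrow> 'a \<Rightarrow> ('a \<Rightarrow> 'a \<Rightarrow> 'k) \<Rightarrow> 'k" where
  "first_defect m D e f \<beta> =
     D (m e f) \<beta> + D (m f e) (\<lambda>u v. \<beta> v u)
     - D e (\<lambda>u v. \<beta> (m u f) v) - D e (\<lambda>u v. \<beta> (m f v) u)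
     - D f (\<lambda>u v. \<beta> u (m e v)) - D f (\<lambda>u v. \<beta> v (m u e))"

text \<open>The bracket of the second axiom minus its image under \<open>tau\<close>, paired with a
  bilinear form; the last four terms are those coming from \<open>tau\<close>.\<close>

definition second_defect ::
  "('a \<Rightarrow> 'a \<Rightarrow> 'a) \<Rightarrow> ('a \<Rightarrow> ('a, 'a, 'k::field) tensor2) \<Rightarrow> 'a \<Rightarrow> 'a \<Rightarrow> ('a \<Rightarrow> 'a \<Rightarrow> 'k) \<Rightarrow> 'k" where
  "second_defect m D e f \<beta> =
     D e (\<lambda>u v. \<beta> u (m v f)) + D f (\<lambda>u v. \<beta> (m e u) v)
     - D e (\<lambda>u v. \<beta> (m f u) v) - D f (\<lambda>u v. \<beta> u (m v e))
     - D e (\<lambda>u v. \<beta> (m v f) u) - D f (\<lambda>u v. \<beta> v (m e u))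
     + D e (\<lambda>u v. \<beta> v (m f u)) + D f (\<lambda>u v. \<beta> (m v e) u)"

text \<open>The six terms are only permuted: the first axiom for \<open>b\<close>, \<open>a\<close>
  is \<open>tau\<close> of the axiom for \<open>a\<close>, \<open>b\<close>.\<close>

lemma first_defect_swap: "first_defect m D f e (\<lambda>u v. \<beta> v u) = first_defect m D e f \<beta>"
  by (simp add: first_defect_def)

lemma second_defect_swap_args: "second_defect m D f e \<beta> = - second_defect m D e f \<beta>"
  by (simp add: second_defect_def)

text \<open>The sign is that of \<open>id - tau\<close> composed with \<open>tau\<close>.\<close>

lemma second_defect_swap_form: "second_defect m D e f (\<lambda>u v. \<beta> v u) = - second_defect m D e f \<beta>"
  by (simp add: second_defect_def)

section \<open>Defects of a bilinear product and a linear coproduct\<close>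

text \<open>Only linear structure is assumed, no anti-flexible identity. The results thus apply to
  \<open>A\<close>, to \<open>A \<oplus> V\<close>, to \<open>E\<close>, and to a pulled back
  structure that is yet to be shown a bialgebra.\<close>

locale product_coproduct = vector_space s
  for s :: "'k::field \<Rightarrow> 'a::ab_group_add \<Rightarrow> 'a" +
  fixes m :: "'a \<Rightarrow> 'a \<Rightarrow> 'a" and D :: "'a \<Rightarrow> ('a, 'a, 'k) tensor2"
  assumes bilinear_m: "bilinear_map s s s m"
    and linear_D: "linear_to_tensors s s s D"
begin

lemma D_zero: "D a (\<lambda>u v. 0) = 0"
  using linear_to_tensors_mem[OF linear_D] by (rule tensor_zero)

lemma D_not_bilinear: "\<not> bilinear_map s s (*) \<beta> \<Longrightarrow> D a \<beta> = 0"
  using linear_to_tensors_mem[OF linear_D] by (rule tensor_not_bilinear)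

lemma D_add_form:
  "bilinear_map s s (*) \<beta> \<Longrightarrow> bilinear_map s s (*) \<beta>' \<Longrightarrow> D a (\<lambda>u v. \<beta> u v + \<beta>' u v) = D a \<beta> + D a \<beta>'"
  using linear_to_tensors_mem[OF linear_D] by (rule tensor_add)

lemma m_add: "m (a + a') b = m a b + m a' b" "m a (b + b') = m a b + m a b'"
  using bilinear_m unfolding bilinear_map_def Vector_Spaces.linear_iff by auto

text \<open>Besides \<open>\<beta>\<close> and its transpose, these are the forms at which the two
  defects evaluate \<open>D\<close>.\<close>

lemma bilinear_forms:
  assumes "bilinear_map s s (*) \<beta>"
  shows "bilinear_map s s (*) (\<lambda>u v. \<beta> (m u f) v)" "bilinear_map s s (*) (\<lambda>u v. \<beta> (m f u) v)"
    "bilinear_map s s (*) (\<lambda>u v. \<beta> u (m v f))" "bilinear_map s s (*) (\<lambda>u v. \<beta> u (m f v))"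
    "bilinear_map s s (*) (\<lambda>u v. \<beta> (m v f) u)" "bilinear_map s s (*) (\<lambda>u v. \<beta> (m f v) u)"
    "bilinear_map s s (*) (\<lambda>u v. \<beta> v (m u f))" "bilinear_map s s (*) (\<lambda>u v. \<beta> v (m f u))"
  using assms bilinear_m unfolding bilinear_map_def Vector_Spaces.linear_iff by simp_all

lemma first_defect_add_form:
  assumes "bilinear_map s s (*) \<beta>" "bilinear_map s s (*) \<beta>'"
  shows "first_defect m D e f (\<lambda>u v. \<beta> u v + \<beta>' u v) = first_defect m D e f \<beta> + first_defect m D e f \<beta>'"
  unfolding first_defect_def
  by (simp add: D_add_form bilinear_forms bilinear_map_swap assms)

lemma second_defect_add_form:
  assumes "bilinear_map s s (*) \<beta>" "bilinear_map s s (*) \<beta>'"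
  shows "second_defect m D e f (\<lambda>u v. \<beta> u v + \<beta>' u v) = second_defect m D e f \<beta> + second_defect m D e f \<beta>'"
  unfolding second_defect_def
  by (simp add: D_add_form bilinear_forms bilinear_map_swap assms)

text \<open>The first equation is one of functions because
  \<open>\<lambda>u v. \<beta> (m u f) v\<close> eta-contracts and leaves \<open>\<beta>\<close>
  with a single argument.\<close>

lemma form_add:
  assumes "bilinear_map s s (*) \<beta>"
  shows "\<beta> (a + a') = (\<lambda>b. \<beta> a b + \<beta> a' b)" "\<beta> a (b + b') = \<beta> a b + \<beta> a b'"
  using assms unfolding bilinear_map_def Vector_Spaces.linear_iff by auto

lemma first_defect_add:
  assumes "bilinear_map s s (*) \<beta>"
  shows "first_defect m D (e + e') f \<beta> = first_defect m D e f \<beta> + first_defect m D e' f \<beta>"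
    and "first_defect m D f (e + e') \<beta> = first_defect m D f e \<beta> + first_defect m D f e' \<beta>"
  unfolding first_defect_def
  by (simp_all add: D_add_form bilinear_forms assms m_add form_add[OF assms] linear_to_tensors_add[OF linear_D])

lemma second_defect_add:
  assumes "bilinear_map s s (*) \<beta>"
  shows "second_defect m D (e + e') f \<beta> = second_defect m D e f \<beta> + second_defect m D e' f \<beta>"
    and "second_defect m D f (e + e') \<beta> = second_defect m D f e \<beta> + second_defect m D f e' \<beta>"
  unfolding second_defect_def
  by (simp_all add: D_add_form bilinear_forms assms m_add form_add[OF assms] linear_to_tensors_add[OF linear_D])

text \<open>Equal tensors are equal at every argument. At a bilinear form the difference of the two
  sides is the defect; at any other argument both sides are 0.\<close>

lemma first_axiom_iff:
  "D (m a b) + tau (D (m b a)) =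
      sweedler (D a) (\<lambda>a1 a2. tens s s (m a1 b) a2)
    + sweedler (D a) (\<lambda>a1 a2. tens s s (m b a2) a1)
    + sweedler (D b) (\<lambda>b1 b2. tens s s b1 (m a b2))
    + sweedler (D b) (\<lambda>b1 b2. tens s s b2 (m b1 a)) \<longleftrightarrow>
   (\<forall>\<beta>. bilinear_map s s (*) \<beta> \<longrightarrow> first_defect m D a b \<beta> = 0)" (is "?L = ?R \<longleftrightarrow> _")
proof -
  have "?L \<beta> = ?R \<beta> \<longleftrightarrow> (bilinear_map s s (*) \<beta> \<longrightarrow> first_defect m D a b \<beta> = 0)" for \<beta>
    by (cases "bilinear_map s s (*) \<beta>")
      (auto simp: first_defect_def sweedler_apply tau_apply tens_apply tens_apply_not_bilinear
        D_zero D_not_bilinear bilinear_map_swap_iff[of s s _ \<beta>] algebra_simps)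
  then show ?thesis unfolding fun_eq_iff by blast
qed

lemma second_axiom_iff:
  "id_minus_tau
      (sweedler (D a) (\<lambda>a1 a2. tens s s a1 (m a2 b))
     + sweedler (D b) (\<lambda>b1 b2. tens s s (m a b1) b2)
     - sweedler (D a) (\<lambda>a1 a2. tens s s (m b a1) a2)
     - sweedler (D b) (\<lambda>b1 b2. tens s s b1 (m b2 a))) = 0 \<longleftrightarrow>
   (\<forall>\<beta>. bilinear_map s s (*) \<beta> \<longrightarrow> second_defect m D a b \<beta> = 0)" (is "?L = 0 \<longleftrightarrow> _")
proof -
  have "?L \<beta> = 0 \<longleftrightarrow> (bilinear_map s s (*) \<beta> \<longrightarrow> second_defect m D a b \<beta> = 0)" for \<beta>
    by (cases "bilinear_map s s (*) \<beta>")
      (auto simp: second_defect_def id_minus_tau_def sweedler_apply tau_apply tens_apply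
        tens_apply_not_bilinear D_zero bilinear_map_swap_iff[of s s _ \<beta>] algebra_simps)
  then show ?thesis unfolding fun_eq_iff by simp
qed

lemma antiflexible_bialgebra_iff:
  "antiflexible_bialgebra s m D \<longleftrightarrow>
     antiflexible_algebra s m \<and> antiflexible_coalgebra s D \<and>
     (\<forall>a b \<beta>. bilinear_map s s (*) \<beta> \<longrightarrow> first_defect m D a b \<beta> = 0) \<and>
     (\<forall>a b \<beta>. bilinear_map s s (*) \<beta> \<longrightarrow> second_defect m D a b \<beta> = 0)"
  unfolding antiflexible_bialgebra_def first_axiom_iff second_axiom_iff by (rule refl)

lemma antiflexible_coalgebra_iff:
  "antiflexible_coalgebra s D \<longleftrightarrow>
     (\<forall>a t. trilinear_map s s s (*) t \<longrightarrow>
        D a (\<lambda>u w. D u (\<lambda>v v'. t v v' w)) - D a (\<lambda>u w. D w (\<lambda>v v'. t u v v')) =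
        D a (\<lambda>u w. D u (\<lambda>v v'. t w v' v)) - D a (\<lambda>u w. D w (\<lambda>v v'. t v' v u)))"
proof -
  \<comment> \<open>Reversal of the arguments preserves trilinearity, so \<open>tau13\<close> leads
    to forms of the same kind, and elsewhere both sides vanish.\<close>
  have sw: "trilinear_map s s s (*) (\<lambda>u v w. t w v u) \<longleftrightarrow> trilinear_map s s s (*) t"
    for t :: "'a \<Rightarrow> 'a \<Rightarrow> 'a \<Rightarrow> 'k"
    unfolding trilinear_map_def by blast
  have "coassociator s D a t = tau13 (coassociator s D a) t \<longleftrightarrow>
     (trilinear_map s s s (*) t \<longrightarrow>
        D a (\<lambda>u w. D u (\<lambda>v v'. t v v' w)) - D a (\<lambda>u w. D w (\<lambda>v v'. t u v v')) =
        D a (\<lambda>u w. D u (\<lambda>v v'. t w v' v)) - D a (\<lambda>u w. D w (\<lambda>v v'. t v' v u)))" for a t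
    by (cases "trilinear_map s s s (*) t")
      (auto simp: coassociator_def tau13_def sweedler_apply tens3_def sw[of t] D_zero)
  then show ?thesis
    unfolding antiflexible_coalgebra_def fun_eq_iff using linear_D by blast
qed

end

section \<open>Unified biproducts\<close>

context extending_datum
begin

section \<open>The direct sum with its projections and inclusions\<close>

lemma vector_space_scaleE: "vector_space scaleE"
proof -
  interpret vector_space_prod sA sV by unfold_locales
  show ?thesis by unfold_locales
qed

lemma scaleE_apply: "scaleE c (a, x) = (sA c a, sV c x)"
proof -
  interpret vector_space_prod sA sV by unfold_locales
  show ?thesis by (rule scale_prod)
qed

lemma linear_fst: "Vector_Spaces.linear scaleE sA fst" and linear_snd: "Vector_Spaces.linear scaleE sV snd"
  using vector_space_scaleE A.vector_space_axioms V.vector_space_axioms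
  unfolding Vector_Spaces.linear_iff by (auto simp: scaleE_apply)

lemma linear_inl: "Vector_Spaces.linear sA scaleE (\<lambda>a. (a, 0))"
  and linear_inr: "Vector_Spaces.linear sV scaleE (\<lambda>x. (0, x))"
  using vector_space_scaleE A.vector_space_axioms V.vector_space_axioms
  unfolding Vector_Spaces.linear_iff by (auto simp: scaleE_apply)

text \<open>Forms on two summands are lifted to \<open>A \<oplus> V\<close> by the projections, and
  forms on \<open>A \<oplus> V\<close> are restricted by the inclusions. Both lists run in the order
  AA, AV, VA, VV, on which numbered selections rely.\<close>

lemmas lift_forms =
  bilinear_map_precompose[OF _ linear_fst linear_fst]
  bilinear_map_precompose[OF _ linear_fst linear_snd]
  bilinear_map_precompose[OF _ linear_snd linear_fst]
  bilinear_map_precompose[OF _ linear_snd linear_snd]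

lemmas restrict_forms =
  bilinear_map_precompose[OF _ linear_inl linear_inl]
  bilinear_map_precompose[OF _ linear_inl linear_inr]
  bilinear_map_precompose[OF _ linear_inr linear_inl]
  bilinear_map_precompose[OF _ linear_inr linear_inr]

lemma linear_DeltaA: "linear_to_tensors sA sA sA \<Delta>\<^sub>A"
  using bialgebra_A unfolding antiflexible_bialgebra_def antiflexible_coalgebra_def by blast

lemma bilinear_mA: "bilinear_map sA sA sA mA"
  using bialgebra_A unfolding antiflexible_bialgebra_def antiflexible_algebra_def by blast

lemmas linear_data =
  linear_DeltaA linear_P linear_phi linear_psi linear_rho linear_gamma linear_DeltaV

lemmas bilinear_data = bilinear_mA bilinear_lact bilinear_ract bilinear_theta bilinear_mV

lemmas data_mem = linear_data[THEN linear_to_tensors_mem]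

text \<open>These rules erase every term of an expanded defect that has a zero component, which
  isolates a single block.\<close>

lemmas data_zero = linear_data[THEN linear_to_tensors_zero] data_mem[THEN tensor_zero]
  bilinear_data[THEN bilinear_map_zeroL] bilinear_data[THEN bilinear_map_zeroR]

lemmas data_not_bilinear = data_mem[THEN tensor_not_bilinear]

section \<open>Decomposition of forms and of pairs of elements\<close>

lemma Delta_E_apply:
  assumes "bilinear_map scaleE scaleE (*) \<beta>"
  shows "Delta_E e \<beta> =
     \<Delta>\<^sub>A (fst e) (\<lambda>u1 u2. \<beta> (u1, 0) (u2, 0)) + \<phi> (fst e) (\<lambda>v u. \<beta> (0, v) (u, 0))
   + \<psi> (fst e) (\<lambda>u v. \<beta> (u, 0) (0, v)) + P (fst e) (\<lambda>v1 v2. \<beta> (0, v1) (0, v2))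
   + \<Delta>\<^sub>V (snd e) (\<lambda>v1 v2. \<beta> (0, v1) (0, v2)) + \<rho> (snd e) (\<lambda>u v. \<beta> (u, 0) (0, v))
   + \<gamma> (snd e) (\<lambda>v u. \<beta> (0, v) (u, 0))"
  by (cases e) (simp add: sweedler_apply tens_apply assms)

text \<open>Every element is \<open>(fst e, 0) + (0, snd e)\<close> and the form is biadditive. As
  an equation of functions it can be substituted inside a functional.\<close>

lemma form_blocks:
  fixes \<beta> :: "'a \<times> 'v \<Rightarrow> 'a \<times> 'v \<Rightarrow> 'k"
  assumes "bilinear_map scaleE scaleE (*) \<beta>"
  shows "\<beta> = (\<lambda>e f. (\<beta> (fst e, 0) (fst f, 0) + \<beta> (fst e, 0) (0, snd f)) +
    (\<beta> (0, snd e) (fst f, 0) + \<beta> (0, snd e) (0, snd f)))"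
proof (intro ext)
  fix e f
  have "\<beta> e f = \<beta> ((fst e, 0) + (0, snd e)) ((fst f, 0) + (0, snd f))" by simp
  also have "\<dots> = (\<beta> (fst e, 0) (fst f, 0) + \<beta> (fst e, 0) (0, snd f)) +
    (\<beta> (0, snd e) (fst f, 0) + \<beta> (0, snd e) (0, snd f))"
  proof -
    have "\<beta> (e + e') f = \<beta> e f + \<beta> e' f" "\<beta> e (f + f') = \<beta> e f + \<beta> e f'" for e e' f f'
      using assms unfolding bilinear_map_def Vector_Spaces.linear_iff by blast+
    then show ?thesis by (simp only: ac_simps)
  qed
  finally show "\<beta> e f = \<dots>" .
qed

text \<open>Lifted block forms are forms on the sum, which gives one direction. For the other, a
  form is the sum of its four lifted restrictions and \<open>F\<close> is additive.\<close>

lemma all_forms_iff: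
  fixes F :: "('a \<times> 'v \<Rightarrow> 'a \<times> 'v \<Rightarrow> 'k) \<Rightarrow> 'k"
  assumes add: "\<And>\<beta> \<beta>'. bilinear_map scaleE scaleE (*) \<beta> \<Longrightarrow> bilinear_map scaleE scaleE (*) \<beta>' \<Longrightarrow>
    F (\<lambda>e f. \<beta> e f + \<beta>' e f) = F \<beta> + F \<beta>'"
  shows "(\<forall>\<beta>. bilinear_map scaleE scaleE (*) \<beta> \<longrightarrow> F \<beta> = 0) \<longleftrightarrow>
    (\<forall>\<beta>. bilinear_map sA sA (*) \<beta> \<longrightarrow> F (\<lambda>e f. \<beta> (fst e) (fst f)) = 0) \<and>
    (\<forall>\<beta>. bilinear_map sA sV (*) \<beta> \<longrightarrow> F (\<lambda>e f. \<beta> (fst e) (snd f)) = 0) \<and>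
    (\<forall>\<beta>. bilinear_map sV sA (*) \<beta> \<longrightarrow> F (\<lambda>e f. \<beta> (snd e) (fst f)) = 0) \<and>
    (\<forall>\<beta>. bilinear_map sV sV (*) \<beta> \<longrightarrow> F (\<lambda>e f. \<beta> (snd e) (snd f)) = 0)" (is "?L \<longleftrightarrow> ?R")
proof
  assume ?L
  then show ?R by (simp add: lift_forms)
next
  assume R: ?R
  show ?L
  proof (intro allI impI)
    fix \<beta> :: "'a \<times> 'v \<Rightarrow> 'a \<times> 'v \<Rightarrow> 'k"
    assume \<beta>: "bilinear_map scaleE scaleE (*) \<beta>"
    note r = restrict_forms[OF \<beta>]
    show "F \<beta> = 0"
      using R[THEN conjunct1, rule_format, OF r(1)]
        R[THEN conjunct2, THEN conjunct1, rule_format, OF r(2)]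
        R[THEN conjunct2, THEN conjunct2, THEN conjunct1, rule_format, OF r(3)]
        R[THEN conjunct2, THEN conjunct2, THEN conjunct2, rule_format, OF r(4)]
      by (subst form_blocks[OF \<beta>])
        (simp add: add bilinear_map_add lift_forms(1)[OF r(1)] lift_forms(2)[OF r(2)]
          lift_forms(3)[OF r(3)] lift_forms(4)[OF r(4)])
  qed
qed

text \<open>Additivity reduces to elements of the summands. Of the two kinds of mixed pairs one is
  enough, since \<open>swap\<close> carries it to the other and \<open>B\<close> is closed under
  transposition.\<close>

lemma all_pairs_iff:
  fixes F :: "'a \<times> 'v \<Rightarrow> 'a \<times> 'v \<Rightarrow> ('a \<times> 'v \<Rightarrow> 'a \<times> 'v \<Rightarrow> 'k) \<Rightarrow> 'k"
  assumes add: "\<And>\<beta> e e' f. B \<beta> \<Longrightarrow> F (e + e') f \<beta> = F e f \<beta> + F e' f \<beta>"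
      "\<And>\<beta> e f f'. B \<beta> \<Longrightarrow> F e (f + f') \<beta> = F e f \<beta> + F e f' \<beta>"
    and swap: "\<And>\<beta> e f. B \<beta> \<Longrightarrow> F e f \<beta> = 0 \<Longrightarrow> F f e (\<lambda>u v. \<beta> v u) = 0"
    and B: "\<And>\<beta>. B \<beta> \<Longrightarrow> B (\<lambda>u v. \<beta> v u)"
  shows "(\<forall>e f \<beta>. B \<beta> \<longrightarrow> F e f \<beta> = 0) \<longleftrightarrow>
    (\<forall>a b \<beta>. B \<beta> \<longrightarrow> F (a, 0) (b, 0) \<beta> = 0) \<and> (\<forall>x b \<beta>. B \<beta> \<longrightarrow> F (0, x) (b, 0) \<beta> = 0) \<and>
    (\<forall>x y \<beta>. B \<beta> \<longrightarrow> F (0, x) (0, y) \<beta> = 0)" (is "?L \<longleftrightarrow> ?R")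
proof
  assume R: ?R
  have "F (a, x) (b, y) \<beta> = 0" if "B \<beta>" for a x b y \<beta>
  proof -
    have "F (a, x) (b, y) \<beta> = F ((a, 0) + (0, x)) ((b, 0) + (0, y)) \<beta>" by simp
    also have "\<dots> = F (a, 0) (b, 0) \<beta> + F (a, 0) (0, y) \<beta> + (F (0, x) (b, 0) \<beta> + F (0, x) (0, y) \<beta>)"
      by (simp only: add that ac_simps)
    \<comment> \<open>\<open>swap\<close> is used at the transposed form, and transposing twice
      gives \<open>\<beta>\<close> back.\<close>
    also have "F (a, 0) (0, y) \<beta> = 0"
      using swap[OF B[OF that], of "(0, y)" "(a, 0)"] R B[OF that] by blast
    finally show ?thesis using R that by simp
  qed
  then show ?L by auto
qed auto

end

text \<open>Both sides of the desired equivalence contain these two properties. They supply the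
  bilinearity of \<open>mult_E\<close> and the linearity of \<open>Delta_E\<close>.\<close>

locale biproduct = extending_datum +
  assumes algebra_E: "antiflexible_algebra scaleE mult_E"
    and coalgebra_E: "antiflexible_coalgebra scaleE Delta_E"

sublocale biproduct \<subseteq> E: product_coproduct scaleE mult_E Delta_E
  using vector_space_scaleE algebra_E coalgebra_E
  unfolding antiflexible_algebra_def antiflexible_coalgebra_def
  by (intro product_coproduct.intro product_coproduct_axioms.intro) auto

sublocale extending_datum \<subseteq> A: product_coproduct sA mA \<Delta>\<^sub>A
  by (intro product_coproduct.intro product_coproduct_axioms.intro A.vector_space_axioms bilinear_mA linear_DeltaA)

context biproduct
begin

abbreviation "first \<equiv> first_defect mult_E Delta_E"
abbreviation "second \<equiv> second_defect mult_E Delta_E"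

section \<open>Each condition as one block of a defect\<close>

lemmas at_form = sweedler_apply tau_apply tens_apply id_minus_tau_def data_zero

text \<open>After expanding \<open>Delta_E\<close> and \<open>mult_E\<close> and dropping terms with
  a zero component, exactly the terms of the condition remain. The same computation proves the
  twelve lemmas up to \<open>E14_iff\<close>.\<close>

lemma E1_iff:
  "E1 \<longleftrightarrow> (\<forall>a b \<beta>. bilinear_map sV sA (*) \<beta> \<longrightarrow>
     first (a, 0) (b, 0) (\<lambda>e f. \<beta> (snd e) (fst f)) = 0)"
  unfolding E1_def fun_eq_iff
proof (intro all_cong1, goal_cases)
  case (1 a b \<beta>)
  show ?case
  proof (cases "bilinear_map sV sA (*) \<beta>")
    case True
    note form = lift_forms(3)[OF True]
    from True show ?thesis
      by (simp add: first_defect_def Delta_E_apply E.bilinear_forms[OF form] bilinear_map_swap[OF form] form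
        bilinear_map_swap[OF True]         bilinear_map_zeroL[OF True] bilinear_map_zeroR[OF True] at_form algebra_simps)
  next
    case False
    \<comment> \<open>Away from bilinear maps the right side is vacuous and the equation of tensors
      reads 0 = 0.\<close>
    then show ?thesis
      by (simp add: at_form tens_apply_not_bilinear data_not_bilinear bilinear_map_swap_iff[of sA sV _ \<beta>])
  qed
qed

lemma E2_iff:
  "E2 \<longleftrightarrow> (\<forall>x y \<beta>. bilinear_map sA sV (*) \<beta> \<longrightarrow>
     first (0, x) (0, y) (\<lambda>e f. \<beta> (fst e) (snd f)) = 0)"
  unfolding E2_def fun_eq_iff
proof (intro all_cong1, goal_cases)
  case (1 x y \<beta>)
  show ?case
  proof (cases "bilinear_map sA sV (*) \<beta>")
    case True
    note form = lift_forms(2)[OF True]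
    from True show ?thesis
      by (simp add: first_defect_def Delta_E_apply E.bilinear_forms[OF form] bilinear_map_swap[OF form] form
        bilinear_map_swap[OF True]         bilinear_map_zeroL[OF True] bilinear_map_zeroR[OF True] at_form algebra_simps)
  next
    case False
    then show ?thesis
      by (simp add: at_form tens_apply_not_bilinear data_not_bilinear bilinear_map_swap_iff[of sV sA _ \<beta>])
  qed
qed

text \<open>The element of \<open>A\<close> comes first here, unlike in \<open>E5_iff\<close> and
  \<open>E6_iff\<close>; \<open>first_VV_swap\<close> later reconciles the orders.\<close>

lemma E3_iff:
  "E3 \<longleftrightarrow> (\<forall>a y \<beta>. bilinear_map sV sV (*) \<beta> \<longrightarrow>
     first (a, 0) (0, y) (\<lambda>e f. \<beta> (snd e) (snd f)) = 0)"
  unfolding E3_def fun_eq_iff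
proof (intro all_cong1, goal_cases)
  case (1 a y \<beta>)
  show ?case
  proof (cases "bilinear_map sV sV (*) \<beta>")
    case True
    note form = lift_forms(4)[OF True]
    from True show ?thesis
      by (simp add: first_defect_def Delta_E_apply E.bilinear_forms[OF form] bilinear_map_swap[OF form] form
        bilinear_map_swap[OF True]         bilinear_map_zeroL[OF True] bilinear_map_zeroR[OF True] at_form algebra_simps)
  next
    case False
    then show ?thesis
      by (simp add: at_form tens_apply_not_bilinear data_not_bilinear bilinear_map_swap_iff[of sV sV _ \<beta>])
  qed
qed

lemma E4_iff:
  "E4 \<longleftrightarrow> (\<forall>a b \<beta>. bilinear_map sV sV (*) \<beta> \<longrightarrow>
     first (a, 0) (b, 0) (\<lambda>e f. \<beta> (snd e) (snd f)) = 0)"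
  unfolding E4_def fun_eq_iff
proof (intro all_cong1, goal_cases)
  case (1 a b \<beta>)
  show ?case
  proof (cases "bilinear_map sV sV (*) \<beta>")
    case True
    note form = lift_forms(4)[OF True]
    from True show ?thesis
      by (simp add: first_defect_def Delta_E_apply E.bilinear_forms[OF form] bilinear_map_swap[OF form] form
        bilinear_map_swap[OF True]         bilinear_map_zeroL[OF True] bilinear_map_zeroR[OF True] at_form algebra_simps)
  next
    case False
    then show ?thesis
      by (simp add: at_form tens_apply_not_bilinear data_not_bilinear bilinear_map_swap_iff[of sV sV _ \<beta>])
  qed
qed

lemma E5_iff:
  "E5 \<longleftrightarrow> (\<forall>x b \<beta>. bilinear_map sV sA (*) \<beta> \<longrightarrow>
     first (0, x) (b, 0) (\<lambda>e f. \<beta> (snd e) (fst f)) = 0)"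
  unfolding E5_def fun_eq_iff
proof (intro all_cong1, goal_cases)
  case (1 x b \<beta>)
  show ?case
  proof (cases "bilinear_map sV sA (*) \<beta>")
    case True
    note form = lift_forms(3)[OF True]
    from True show ?thesis
      by (simp add: first_defect_def Delta_E_apply E.bilinear_forms[OF form] bilinear_map_swap[OF form] form
        bilinear_map_swap[OF True]         bilinear_map_zeroL[OF True] bilinear_map_zeroR[OF True] at_form algebra_simps)
  next
    case False
    then show ?thesis
      by (simp add: at_form tens_apply_not_bilinear data_not_bilinear bilinear_map_swap_iff[of sA sV _ \<beta>])
  qed
qed

lemma E6_iff:
  "E6 \<longleftrightarrow> (\<forall>x b \<beta>. bilinear_map sA sV (*) \<beta> \<longrightarrow>
     first (0, x) (b, 0) (\<lambda>e f. \<beta> (fst e) (snd f)) = 0)"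
  unfolding E6_def fun_eq_iff
proof (intro all_cong1, goal_cases)
  case (1 x b \<beta>)
  show ?case
  proof (cases "bilinear_map sA sV (*) \<beta>")
    case True
    note form = lift_forms(2)[OF True]
    from True show ?thesis
      by (simp add: first_defect_def Delta_E_apply E.bilinear_forms[OF form] bilinear_map_swap[OF form] form
        bilinear_map_swap[OF True]         bilinear_map_zeroL[OF True] bilinear_map_zeroR[OF True] at_form algebra_simps)
  next
    case False
    then show ?thesis
      by (simp add: at_form tens_apply_not_bilinear data_not_bilinear bilinear_map_swap_iff[of sV sA _ \<beta>])
  qed
qed

text \<open>On a mixed block \<open>id - tau\<close> subtracts from one mixed part of the bracket
  the transpose of the other, hence an equation with \<open>tau\<close> on one side.\<close>

lemma E7_iff:
  "E7 \<longleftrightarrow> (\<forall>a b \<beta>. bilinear_map sA sV (*) \<beta> \<longrightarrow>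
     second (a, 0) (b, 0) (\<lambda>e f. \<beta> (fst e) (snd f)) = 0)"
  unfolding E7_def fun_eq_iff
proof (intro all_cong1, goal_cases)
  case (1 a b \<beta>)
  show ?case
  proof (cases "bilinear_map sA sV (*) \<beta>")
    case True
    note form = lift_forms(2)[OF True]
    from True show ?thesis
      by (simp add: second_defect_def Delta_E_apply E.bilinear_forms[OF form] bilinear_map_swap[OF form] form
        bilinear_map_swap[OF True]         bilinear_map_zeroL[OF True] bilinear_map_zeroR[OF True] at_form algebra_simps)
  next
    case False
    then show ?thesis
      by (simp add: at_form tens_apply_not_bilinear data_not_bilinear bilinear_map_swap_iff[of sV sA _ \<beta>])
  qed
qed

text \<open>\<open>tau\<close> preserves the \<open>V \<otimes> V\<close> part of the bracket, so
  \<open>id_minus_tau\<close> survives in the condition.\<close>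

lemma E8_iff:
  "E8 \<longleftrightarrow> (\<forall>a b \<beta>. bilinear_map sV sV (*) \<beta> \<longrightarrow>
     second (a, 0) (b, 0) (\<lambda>e f. \<beta> (snd e) (snd f)) = 0)"
  unfolding E8_def fun_eq_iff
proof (intro all_cong1, goal_cases)
  case (1 a b \<beta>)
  show ?case
  proof (cases "bilinear_map sV sV (*) \<beta>")
    case True
    note form = lift_forms(4)[OF True]
    from True show ?thesis
      by (simp add: second_defect_def Delta_E_apply E.bilinear_forms[OF form] bilinear_map_swap[OF form] form
        bilinear_map_swap[OF True]         bilinear_map_zeroL[OF True] bilinear_map_zeroR[OF True] at_form algebra_simps)
  next
    case False
    then show ?thesis
      by (simp add: at_form tens_apply_not_bilinear data_not_bilinear bilinear_map_swap_iff[of sV sV _ \<beta>])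
  qed
qed

lemma E9_iff:
  "E9 \<longleftrightarrow> (\<forall>x b \<beta>. bilinear_map sV sA (*) \<beta> \<longrightarrow>
     second (0, x) (b, 0) (\<lambda>e f. \<beta> (snd e) (fst f)) = 0)"
  unfolding E9_def fun_eq_iff
proof (intro all_cong1, goal_cases)
  case (1 x b \<beta>)
  show ?case
  proof (cases "bilinear_map sV sA (*) \<beta>")
    case True
    note form = lift_forms(3)[OF True]
    from True show ?thesis
      by (simp add: second_defect_def Delta_E_apply E.bilinear_forms[OF form] bilinear_map_swap[OF form] form
        bilinear_map_swap[OF True]         bilinear_map_zeroL[OF True] bilinear_map_zeroR[OF True] at_form algebra_simps)
  next
    case False
    then show ?thesis
      by (simp add: at_form tens_apply_not_bilinear data_not_bilinear bilinear_map_swap_iff[of sA sV _ \<beta>])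
  qed
qed

lemma E10_iff:
  "E10 \<longleftrightarrow> (\<forall>x b \<beta>. bilinear_map sV sV (*) \<beta> \<longrightarrow>
     second (0, x) (b, 0) (\<lambda>e f. \<beta> (snd e) (snd f)) = 0)"
  unfolding E10_def fun_eq_iff
proof (intro all_cong1, goal_cases)
  case (1 x b \<beta>)
  show ?case
  proof (cases "bilinear_map sV sV (*) \<beta>")
    case True
    note form = lift_forms(4)[OF True]
    from True show ?thesis
      by (simp add: second_defect_def Delta_E_apply E.bilinear_forms[OF form] bilinear_map_swap[OF form] form
        bilinear_map_swap[OF True]         bilinear_map_zeroL[OF True] bilinear_map_zeroR[OF True] at_form algebra_simps)
  next
    case False
    then show ?thesis
      by (simp add: at_form tens_apply_not_bilinear data_not_bilinear bilinear_map_swap_iff[of sV sV _ \<beta>])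
  qed
qed

lemma E12_iff:
  "E12 \<longleftrightarrow> (\<forall>x y \<beta>. bilinear_map sV sA (*) \<beta> \<longrightarrow>
     second (0, x) (0, y) (\<lambda>e f. \<beta> (snd e) (fst f)) = 0)"
  unfolding E12_def fun_eq_iff
proof (intro all_cong1, goal_cases)
  case (1 x y \<beta>)
  show ?case
  proof (cases "bilinear_map sV sA (*) \<beta>")
    case True
    note form = lift_forms(3)[OF True]
    from True show ?thesis
      by (simp add: second_defect_def Delta_E_apply E.bilinear_forms[OF form] bilinear_map_swap[OF form] form
        bilinear_map_swap[OF True]         bilinear_map_zeroL[OF True] bilinear_map_zeroR[OF True] at_form algebra_simps)
  next
    case False
    then show ?thesis
      by (simp add: at_form tens_apply_not_bilinear data_not_bilinear bilinear_map_swap_iff[of sA sV _ \<beta>])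
  qed
qed

lemma E13_iff:
  "E13 \<longleftrightarrow> (\<forall>x y \<beta>. bilinear_map sV sV (*) \<beta> \<longrightarrow>
     first (0, x) (0, y) (\<lambda>e f. \<beta> (snd e) (snd f)) = 0)"
  unfolding E13_def fun_eq_iff
proof (intro all_cong1, goal_cases)
  case (1 x y \<beta>)
  show ?case
  proof (cases "bilinear_map sV sV (*) \<beta>")
    case True
    note form = lift_forms(4)[OF True]
    from True show ?thesis
      by (simp add: first_defect_def Delta_E_apply E.bilinear_forms[OF form] bilinear_map_swap[OF form] form
        bilinear_map_swap[OF True]         bilinear_map_zeroL[OF True] bilinear_map_zeroR[OF True] at_form algebra_simps)
  next
    case False
    then show ?thesis
      by (simp add: at_form tens_apply_not_bilinear data_not_bilinear bilinear_map_swap_iff[of sV sV _ \<beta>])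
  qed
qed

lemma E14_iff:
  "E14 \<longleftrightarrow> (\<forall>x y \<beta>. bilinear_map sV sV (*) \<beta> \<longrightarrow>
     second (0, x) (0, y) (\<lambda>e f. \<beta> (snd e) (snd f)) = 0)"
  unfolding E14_def fun_eq_iff
proof (intro all_cong1, goal_cases)
  case (1 x y \<beta>)
  show ?case
  proof (cases "bilinear_map sV sV (*) \<beta>")
    case True
    note form = lift_forms(4)[OF True]
    from True show ?thesis
      by (simp add: second_defect_def Delta_E_apply E.bilinear_forms[OF form] bilinear_map_swap[OF form] form
        bilinear_map_swap[OF True]         bilinear_map_zeroL[OF True] bilinear_map_zeroR[OF True] at_form algebra_simps)
  next
    case False
    then show ?thesis
      by (simp add: at_form tens_apply_not_bilinear data_not_bilinear bilinear_map_swap_iff[of sV sV _ \<beta>])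
  qed
qed

section \<open>Assembling the conditions from the blocks\<close>

text \<open>The first component of a product is the product in \<open>A\<close>, and the
  \<open>A \<otimes> A\<close> part of \<open>Delta_E\<close> is \<open>\<Delta>\<^sub>A\<close> on
  \<open>A\<close> and 0 on \<open>V\<close>. So this block of a defect is a defect of the bialgebra
  \<open>A\<close>, or 0 once the first element lies in \<open>V\<close>.\<close>

lemma defect_AA:
  assumes "bilinear_map sA sA (*) \<beta>"
  shows "first (a, 0) (b, 0) (\<lambda>e f. \<beta> (fst e) (fst f)) = 0"
    "first (0, x) f (\<lambda>e f. \<beta> (fst e) (fst f)) = 0"
    "second (a, 0) (b, 0) (\<lambda>e f. \<beta> (fst e) (fst f)) = 0"
    "second (0, x) f (\<lambda>e f. \<beta> (fst e) (fst f)) = 0"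
proof -
  note form = lift_forms(1)[OF assms]
  note eval = Delta_E_apply at_form E.bilinear_forms[OF form] bilinear_map_swap[OF form] form
    bilinear_map_zeroL[OF assms] bilinear_map_zeroR[OF assms]
  have "first_defect mA \<Delta>\<^sub>A a b \<beta> = 0" "second_defect mA \<Delta>\<^sub>A a b \<beta> = 0"
    using bialgebra_A assms unfolding A.antiflexible_bialgebra_iff by blast+
  then show "first (a, 0) (b, 0) (\<lambda>e f. \<beta> (fst e) (fst f)) = 0"
    "second (a, 0) (b, 0) (\<lambda>e f. \<beta> (fst e) (fst f)) = 0"
    by (simp_all add: first_defect_def second_defect_def eval)
  show "first (0, x) f (\<lambda>e f. \<beta> (fst e) (fst f)) = 0"
    "second (0, x) f (\<lambda>e f. \<beta> (fst e) (fst f)) = 0"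
    by (cases f; simp add: first_defect_def second_defect_def eval)+
qed

text \<open>Transposing the form in the first defect forces an exchange of the two elements.\<close>

lemma first_AV_iff_VA:
  "(\<forall>\<beta>. bilinear_map sA sV (*) \<beta> \<longrightarrow> first e f (\<lambda>u v. \<beta> (fst u) (snd v)) = 0) \<longleftrightarrow>
   (\<forall>\<beta>. bilinear_map sV sA (*) \<beta> \<longrightarrow> first f e (\<lambda>u v. \<beta> (snd u) (fst v)) = 0)"
  by (subst all_bilinear_maps_swap) (simp only: first_defect_swap[of _ _ e f, symmetric])

text \<open>Transposing only changes the sign of the second defect, so the elements keep their
  order.\<close>

lemma second_AV_iff_VA:
  "(\<forall>\<beta>. bilinear_map sA sV (*) \<beta> \<longrightarrow> second e f (\<lambda>u v. \<beta> (fst u) (snd v)) = 0) \<longleftrightarrow>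
   (\<forall>\<beta>. bilinear_map sV sA (*) \<beta> \<longrightarrow> second e f (\<lambda>u v. \<beta> (snd u) (fst v)) = 0)"
proof -
  have "second e f (\<lambda>u v. \<beta> (snd v) (fst u)) = - second e f (\<lambda>u v. \<beta> (snd u) (fst v))" for \<beta>
    by (rule second_defect_swap_form)
  then show ?thesis by (subst all_bilinear_maps_swap) simp
qed

lemma first_VV_swap:
  "(\<forall>\<beta>. bilinear_map sV sV (*) \<beta> \<longrightarrow> first e f (\<lambda>u v. \<beta> (snd u) (snd v)) = 0) \<longleftrightarrow>
   (\<forall>\<beta>. bilinear_map sV sV (*) \<beta> \<longrightarrow> first f e (\<lambda>u v. \<beta> (snd u) (snd v)) = 0)"
  by (subst all_bilinear_maps_swap) (simp only: first_defect_swap[of _ _ e f, symmetric])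

abbreviation "form_E \<beta> \<equiv> bilinear_map scaleE scaleE (*) \<beta>"

text \<open>For two elements of \<open>A\<close> the mixed blocks give \<open>E1\<close> and the VV
  block \<open>E4\<close>; for one of \<open>V\<close> and one of \<open>A\<close> the blocks give
  \<open>E5\<close>, \<open>E6\<close> and \<open>E3\<close>; for two of \<open>V\<close> they give
  \<open>E2\<close> and \<open>E13\<close>.\<close>

lemma first_iff: "(\<forall>e f \<beta>. form_E \<beta> \<longrightarrow> first e f \<beta> = 0) \<longleftrightarrow> E1 \<and> E2 \<and> E3 \<and> E4 \<and> E5 \<and> E6 \<and> E13"
proof -
  have swap: "first e f \<beta> = 0 \<Longrightarrow> first f e (\<lambda>u v. \<beta> v u) = 0" for e f \<beta>
    by (simp only: first_defect_swap[of _ _ f e \<beta>])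
  \<comment> \<open>Naming the blocks hides the defects, so that in the end only quantifiers have to
    be rearranged.\<close>
  define VA where "VA e f \<longleftrightarrow> (\<forall>\<beta>. bilinear_map sV sA (*) \<beta> \<longrightarrow> first e f (\<lambda>u v. \<beta> (snd u) (fst v)) = 0)" for e f
  define VV where "VV e f \<longleftrightarrow> (\<forall>\<beta>. bilinear_map sV sV (*) \<beta> \<longrightarrow> first e f (\<lambda>u v. \<beta> (snd u) (snd v)) = 0)" for e f
  have pairs: "(\<forall>e f \<beta>. form_E \<beta> \<longrightarrow> first e f \<beta> = 0) \<longleftrightarrow>
    (\<forall>a b \<beta>. form_E \<beta> \<longrightarrow> first (a, 0) (b, 0) \<beta> = 0) \<and>
    (\<forall>x b \<beta>. form_E \<beta> \<longrightarrow> first (0, x) (b, 0) \<beta> = 0) \<and>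
    (\<forall>x y \<beta>. form_E \<beta> \<longrightarrow> first (0, x) (0, y) \<beta> = 0)"
    by (rule all_pairs_iff[where F = first, OF E.first_defect_add swap bilinear_map_swap])
  have forms: "(\<forall>\<beta>. form_E \<beta> \<longrightarrow> first e f \<beta> = 0) \<longleftrightarrow>
    (\<forall>\<beta>. bilinear_map sA sA (*) \<beta> \<longrightarrow> first e f (\<lambda>u v. \<beta> (fst u) (fst v)) = 0) \<and>
    (\<forall>\<beta>. bilinear_map sA sV (*) \<beta> \<longrightarrow> first e f (\<lambda>u v. \<beta> (fst u) (snd v)) = 0) \<and>
    (\<forall>\<beta>. bilinear_map sV sA (*) \<beta> \<longrightarrow> first e f (\<lambda>u v. \<beta> (snd u) (fst v)) = 0) \<and>
    (\<forall>\<beta>. bilinear_map sV sV (*) \<beta> \<longrightarrow> first e f (\<lambda>u v. \<beta> (snd u) (snd v)) = 0)" for e f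
    by (rule all_forms_iff[OF E.first_defect_add_form])
  show ?thesis
    unfolding pairs
    \<comment> \<open>The arguments of \<open>first_VV_swap\<close> are fixed in shape, so it turns
      the pair in \<open>E3\<close> around and cannot loop.\<close>
    unfolding forms E1_iff E2_iff E3_iff E4_iff E5_iff E6_iff E13_iff
      first_VV_swap[of "(_, 0)" "(0, _)"]
    unfolding first_AV_iff_VA VA_def[symmetric] VV_def[symmetric] by (auto simp: defect_AA)
qed

text \<open>For two elements of \<open>A\<close> the blocks give \<open>E7\<close> and
  \<open>E8\<close>, for one of \<open>V\<close> and one of \<open>A\<close> they give
  \<open>E9\<close> and \<open>E10\<close>, for two of \<open>V\<close> they give \<open>E12\<close>
  and \<open>E14\<close>.\<close>

lemma second_iff:
  "(\<forall>e f \<beta>. form_E \<beta> \<longrightarrow> second e f \<beta> = 0) \<longleftrightarrow> E7 \<and> E8 \<and> E9 \<and> E10 \<and> E12 \<and> E14"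
proof -
  \<comment> \<open>The signs from exchanging the elements and from transposing the form
    cancel.\<close>
  have swap: "second e f \<beta> = 0 \<Longrightarrow> second f e (\<lambda>u v. \<beta> v u) = 0" for e f \<beta>
    by (simp only: second_defect_swap_form[of _ _ f e \<beta>] second_defect_swap_args[of _ _ f e \<beta>] neg_equal_0_iff_equal)
  have pairs: "(\<forall>e f \<beta>. form_E \<beta> \<longrightarrow> second e f \<beta> = 0) \<longleftrightarrow>
    (\<forall>a b \<beta>. form_E \<beta> \<longrightarrow> second (a, 0) (b, 0) \<beta> = 0) \<and>
    (\<forall>x b \<beta>. form_E \<beta> \<longrightarrow> second (0, x) (b, 0) \<beta> = 0) \<and>
    (\<forall>x y \<beta>. form_E \<beta> \<longrightarrow> second (0, x) (0, y) \<beta> = 0)"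
    by (rule all_pairs_iff[where F = second, OF E.second_defect_add swap bilinear_map_swap])
  have forms: "(\<forall>\<beta>. form_E \<beta> \<longrightarrow> second e f \<beta> = 0) \<longleftrightarrow>
    (\<forall>\<beta>. bilinear_map sA sA (*) \<beta> \<longrightarrow> second e f (\<lambda>u v. \<beta> (fst u) (fst v)) = 0) \<and>
    (\<forall>\<beta>. bilinear_map sA sV (*) \<beta> \<longrightarrow> second e f (\<lambda>u v. \<beta> (fst u) (snd v)) = 0) \<and>
    (\<forall>\<beta>. bilinear_map sV sA (*) \<beta> \<longrightarrow> second e f (\<lambda>u v. \<beta> (snd u) (fst v)) = 0) \<and>
    (\<forall>\<beta>. bilinear_map sV sV (*) \<beta> \<longrightarrow> second e f (\<lambda>u v. \<beta> (snd u) (snd v)) = 0)" for e f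
    by (rule all_forms_iff[OF E.second_defect_add_form])
  show ?thesis
    unfolding pairs
    unfolding forms E7_iff E8_iff E9_iff E10_iff E12_iff E14_iff
    unfolding second_AV_iff_VA by (simp add: defect_AA all_conj_distrib)
qed

lemma antiflexible_bialgebra_E_iff: "antiflexible_bialgebra scaleE mult_E Delta_E \<longleftrightarrow> biproduct_conditions"
  unfolding E.antiflexible_bialgebra_iff biproduct_conditions_def first_iff second_iff by blast

end

text \<open>If the algebra or the coalgebra condition fails, both sides are false; otherwise the
  locale \<open>biproduct\<close> applies.\<close>

theorem (in extending_datum) biproduct_iff:
  "antiflexible_bialgebra scaleE mult_E Delta_E \<longleftrightarrow> biproduct_conditions"
proof -
  have "biproduct sA sV mA \<Delta>\<^sub>A lact ract \<theta> P mV \<phi> \<psi> \<rho> \<gamma> \<Delta>\<^sub>V"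
    if "antiflexible_algebra scaleE mult_E" "antiflexible_coalgebra scaleE Delta_E"
    using extending_datum_axioms that by (intro biproduct.intro biproduct_axioms.intro)
  from biproduct.antiflexible_bialgebra_E_iff[OF this] show ?thesis
    unfolding antiflexible_bialgebra_def biproduct_conditions_def by blast
qed

section \<open>Pulling back a bialgebra structure\<close>

text \<open>Wherever operations are composed, an inner \<open>g\<close> meets an outer
  \<open>f\<close> and cancels. Each identity thus becomes one of \<open>E\<close> at images under
  \<open>f\<close>, with forms composed with \<open>g\<close>.\<close>

lemma antiflexible_bialgebra_transport:
  fixes s :: "'k::field \<Rightarrow> 'b::ab_group_add \<Rightarrow> 'b" and sE :: "'k \<Rightarrow> 'e::ab_group_add \<Rightarrow> 'e"
  assumes bialgebra: "antiflexible_bialgebra sE mE D"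
    and f: "Vector_Spaces.linear s sE f" and g: "Vector_Spaces.linear sE s g"
    and fg: "\<And>e. f (g e) = e"
    and m': "\<And>a b. m' a b = g (mE (f a) (f b))"
    and D': "\<And>a. D' a = sweedler (D (f a)) (\<lambda>u v. tens s s (g u) (g v))"
  shows "antiflexible_bialgebra s m' D'"
proof -
  have vs: "vector_space s" "vector_space sE" and bm: "bilinear_map sE sE sE mE"
    and lD: "linear_to_tensors sE sE sE D"
    using f bialgebra
    unfolding Vector_Spaces.linear_iff antiflexible_bialgebra_def antiflexible_algebra_def antiflexible_coalgebra_def
    by blast+
  interpret E: product_coproduct sE mE D
    using vs bm lD by (intro product_coproduct.intro product_coproduct_axioms.intro)
  have bm': "bilinear_map s s s m'"
    unfolding m' by (rule bilinear_map_compose[OF bilinear_map_precompose[OF bm f f] g])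
  have lD': "linear_to_tensors s s s D'"
    unfolding D' by (rule linear_to_tensors_map[OF lD f g g])
  interpret B: product_coproduct s m' D'
    using vs bm' lD' by (intro product_coproduct.intro product_coproduct_axioms.intro)
  have D'_apply: "D' a \<beta> = D (f a) (\<lambda>u v. \<beta> (g u) (g v))" if "bilinear_map s s (*) \<beta>" for a \<beta>
    using that by (simp add: D' sweedler_apply tens_apply)
  have lift: "bilinear_map sE sE (*) (\<lambda>u v. \<beta> (g u) (g v))" if "bilinear_map s s (*) \<beta>" for \<beta>
    using that by (rule bilinear_map_precompose[OF _ g g])
  have alg: "antiflexible_algebra s m'"
    unfolding antiflexible_algebra_def
  proof (intro conjI allI bm')
    fix a b c
    have "g x - g y = g (x - y)" for x y
      using g unfolding Vector_Spaces.linear_iff by (metis add_diff_cancel diff_add_cancel)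
    moreover have "mE (mE (f a) (f b)) (f c) - mE (f a) (mE (f b) (f c)) =
        mE (mE (f c) (f b)) (f a) - mE (f c) (mE (f b) (f a))"
      using bialgebra unfolding antiflexible_bialgebra_def antiflexible_algebra_def by blast
    ultimately show "m' (m' a b) c - m' a (m' b c) = m' (m' c b) a - m' c (m' b a)"
      by (simp add: m' fg)
  qed
  \<comment> \<open>\<open>D'_apply\<close> needs a bilinear argument, so the inner coproduct is
    first shown to be bilinear in the outer variables.\<close>
  have iterate:
    "D' a (\<lambda>u w. D' u (\<lambda>v v'. t v v' w)) = D (f a) (\<lambda>u w. D u (\<lambda>v v'. t (g v) (g v') (g w)))"
    "D' a (\<lambda>u w. D' w (\<lambda>v v'. t u v v')) = D (f a) (\<lambda>u w. D w (\<lambda>v v'. t (g u) (g v) (g v')))"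
    if t: "trilinear_map s s s (*) t" for t a
  proof -
    have slices: "bilinear_map s s (*) (\<lambda>v v'. t v v' w)" "bilinear_map s s (*) (\<lambda>v v'. t w v v')"
      "bilinear_map s s (*) (\<lambda>v v'. t v w v')" for w
      using t unfolding trilinear_map_def bilinear_map_def by blast+
    have "t (x + y) = (\<lambda>v v'. t x v v' + t y v v')" "t (s c x) = (\<lambda>v v'. c * t x v v')" for c x y
      using t unfolding trilinear_map_def Vector_Spaces.linear_iff by (simp_all add: fun_eq_iff)
    then have "bilinear_map s s (*) (\<lambda>u w. D' u (\<lambda>v v'. t v v' w))"
      "bilinear_map s s (*) (\<lambda>u w. D' w (\<lambda>v v'. t u v v'))"
      using slices t
      unfolding bilinear_map_iff[OF vs(1) vs(1) vector_space_field] trilinear_map_def Vector_Spaces.linear_iff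
      by (simp_all add: linear_to_tensors_add[OF lD'] linear_to_tensors_scale[OF lD']
          B.D_add_form tensor_scale[OF linear_to_tensors_mem[OF lD']] slices)
    then show "D' a (\<lambda>u w. D' u (\<lambda>v v'. t v v' w)) = D (f a) (\<lambda>u w. D u (\<lambda>v v'. t (g v) (g v') (g w)))"
      "D' a (\<lambda>u w. D' w (\<lambda>v v'. t u v v')) = D (f a) (\<lambda>u w. D w (\<lambda>v v'. t (g u) (g v) (g v')))"
      by (simp_all add: D'_apply slices fg)
  qed
  have coalg: "antiflexible_coalgebra s D'"
    unfolding B.antiflexible_coalgebra_iff
  proof (intro allI impI)
    fix a t assume t: "trilinear_map s s s (*) t"
    \<comment> \<open>The reversed form accounts for the \<open>tau13\<close> side of the
      identity.\<close>
    have r: "trilinear_map s s s (*) (\<lambda>u v w. t w v u)"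
      using t unfolding trilinear_map_def by blast
    have "trilinear_map sE sE sE (*) (\<lambda>u v w. t (g u) (g v) (g w))"
      using t g unfolding trilinear_map_def Vector_Spaces.linear_iff by simp
    with bialgebra iterate[OF t] iterate[OF r]
    show "D' a (\<lambda>u w. D' u (\<lambda>v v'. t v v' w)) - D' a (\<lambda>u w. D' w (\<lambda>v v'. t u v v')) =
        D' a (\<lambda>u w. D' u (\<lambda>v v'. t w v' v)) - D' a (\<lambda>u w. D' w (\<lambda>v v'. t v' v u))"
      unfolding antiflexible_bialgebra_def E.antiflexible_coalgebra_iff by simp
  qed
  have "first_defect m' D' a b \<beta> = first_defect mE D (f a) (f b) (\<lambda>u v. \<beta> (g u) (g v))"
    "second_defect m' D' a b \<beta> = second_defect mE D (f a) (f b) (\<lambda>u v. \<beta> (g u) (g v))"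
    if "bilinear_map s s (*) \<beta>" for a b \<beta>
    using that
    \<comment> \<open>\<open>m'\<close> stays folded until all forms built with it have been
      recognised as bilinear.\<close>
    by (simp_all add: first_defect_def second_defect_def D'_apply B.bilinear_forms bilinear_map_swap)
      (simp_all add: m' fg)
  with alg coalg lift bialgebra show ?thesis
    unfolding B.antiflexible_bialgebra_iff E.antiflexible_bialgebra_iff by simp
qed

section \<open>Extensions\<close>

text \<open>The \<open>A\<close>-part of \<open>e\<close> must be \<open>p e\<close>, and
  injectivity of \<open>iV\<close> makes the rest unique. Sums and multiples of decompositions are
  decompositions, so uniqueness makes \<open>q\<close> linear.\<close>

lemma complemented_inclusion_projection:
  assumes incl: "complemented_inclusion sA sV sE iA iV"
    and p: "Vector_Spaces.linear sE sA p" "\<And>a x. p (iA a + iV x) = a"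
  obtains q where "Vector_Spaces.linear sE sV q" "\<And>a x. q (iA a + iV x) = x"
    "\<And>e. iA (p e) + iV (q e) = e"
proof -
  have i: "Vector_Spaces.linear sA sE iA" "Vector_Spaces.linear sV sE iV" "inj iV"
    "\<And>e. \<exists>a x. e = iA a + iV x"
    using incl unfolding complemented_inclusion_def by blast+
  have "\<exists>x. iA (p e) + iV x = e" for e
    using i(4)[of e] p(2) by metis
  then obtain q where q: "\<And>e. iA (p e) + iV (q e) = e" by metis
  have qf: "q (iA a + iV x) = x" for a x
    using q[of "iA a + iV x"] p(2) i(3) by (simp add: inj_eq)
  have "q (e + e') = q e + q e'" for e e'
  proof -
    have "e + e' = iA (p e + p e') + iV (q e + q e')"
      using i(1,2) q[of e] q[of e'] unfolding Vector_Spaces.linear_iff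
      by (metis (no_types, lifting) add.assoc add.left_commute)
    then show ?thesis by (simp only: qf)
  qed
  moreover have "q (sE c e) = sV c (q e)" for c e
  proof -
    have "sE c (iA (p e) + iV (q e)) = iA (sA c (p e)) + iV (sV c (q e))"
      using i(1,2) unfolding Vector_Spaces.linear_iff
      by (metis vector_space.vector_space_assms(1))
    then show ?thesis by (simp only: q qf)
  qed
  ultimately have "Vector_Spaces.linear sE sV q"
    using i(2) unfolding Vector_Spaces.linear_iff by blast
  with qf q that show thesis by blast
qed

lemma extension_is_biproduct:
  fixes sA :: "'k::field_char_0 \<Rightarrow> 'a::ab_group_add \<Rightarrow> 'a"
    and sV :: "'k \<Rightarrow> 'v::ab_group_add \<Rightarrow> 'v"
    and sE :: "'k \<Rightarrow> 'e::ab_group_add \<Rightarrow> 'e"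
  assumes bialgebra_A: "antiflexible_bialgebra sA mA \<Delta>\<^sub>A"
    and incl: "complemented_inclusion sA sV sE iA iV"
    and proj: "\<And>a x. p (iA a + iV x) = a"
    and bialgebra: "antiflexible_bialgebra sE mE \<Delta>"
    and alg_hom: "algebra_hom sE mE sA mA p"
    and coalg_hom: "coalgebra_hom sE \<Delta> sA \<Delta>\<^sub>A p"
  shows "\<exists>lact ract \<theta> P mV \<phi> \<psi> \<rho> \<gamma> \<Delta>\<^sub>V.
        extending_datum sA sV mA \<Delta>\<^sub>A lact ract \<theta> P mV \<phi> \<psi> \<rho> \<gamma> \<Delta>\<^sub>V \<and>
        extending_datum.biproduct_conditions sA sV mA \<Delta>\<^sub>A lact ract \<theta> P mV \<phi> \<psi> \<rho> \<gamma> \<Delta>\<^sub>V \<and>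
        algebra_hom (module_prod.scale sA sV) (extending_datum.mult_E mA lact ract \<theta> mV)
          sE mE (\<lambda>(a, x). iA a + iV x) \<and>
        coalgebra_hom (module_prod.scale sA sV)
          (extending_datum.Delta_E sA sV \<Delta>\<^sub>A P \<phi> \<psi> \<rho> \<gamma> \<Delta>\<^sub>V)
          sE \<Delta> (\<lambda>(a, x). iA a + iV x)"
proof -
  have p: "Vector_Spaces.linear sE sA p" and p_mult: "\<And>e e'. p (mE e e') = mA (p e) (p e')"
    using alg_hom unfolding algebra_hom_def by blast+
  have iA: "Vector_Spaces.linear sA sE iA" and iV: "Vector_Spaces.linear sV sE iV"
    using incl unfolding complemented_inclusion_def by blast+
  have vs: "vector_space sA" "vector_space sV" "vector_space sE"
    using iA iV unfolding Vector_Spaces.linear_iff by blast+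
  have bmE: "bilinear_map sE sE sE mE" and l\<Delta>: "linear_to_tensors sE sE sE \<Delta>"
    using bialgebra
    unfolding antiflexible_bialgebra_def antiflexible_algebra_def antiflexible_coalgebra_def by blast+
  interpret D: product_coproduct sE mE \<Delta>
    using vs(3) bmE l\<Delta> by (intro product_coproduct.intro product_coproduct_axioms.intro)
  obtain q where q: "Vector_Spaces.linear sE sV q" and qf: "\<And>a x. q (iA a + iV x) = x"
    and fg: "\<And>e. iA (p e) + iV (q e) = e"
    using complemented_inclusion_projection[OF incl p proj] by blast
  have "iA (0 + 0) = iA 0 + iA 0" "iV (0 + 0) = iV 0 + iV 0"
    using iA iV unfolding Vector_Spaces.linear_iff by blast+
  then have zero: "iA 0 = 0" "iV 0 = 0" by simp_all

  \<comment> \<open>The \<open>V\<close>-components of products of elements of the two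
    summands.\<close>
  define lact where "lact a y = q (mE (iA a) (iV y))" for a y
  define ract where "ract x b = q (mE (iV x) (iA b))" for x b
  define \<theta> where "\<theta> a b = q (mE (iA a) (iA b))" for a b
  define mV where "mV x y = q (mE (iV x) (iV y))" for x y
  \<comment> \<open>The blocks of the comultiplication on \<open>A\<close> and on \<open>V\<close>,
    apart from the \<open>A \<otimes> A\<close> blocks, which are determined by
    \<open>p\<close>.\<close>
  define \<phi> where "\<phi> a = sweedler (\<Delta> (iA a)) (\<lambda>u v. tens sV sA (q u) (p v))" for a
  define \<psi> where "\<psi> a = sweedler (\<Delta> (iA a)) (\<lambda>u v. tens sA sV (p u) (q v))" for a
  define P where "P a = sweedler (\<Delta> (iA a)) (\<lambda>u v. tens sV sV (q u) (q v))" for a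
  define \<rho> where "\<rho> x = sweedler (\<Delta> (iV x)) (\<lambda>u v. tens sA sV (p u) (q v))" for x
  define \<gamma> where "\<gamma> x = sweedler (\<Delta> (iV x)) (\<lambda>u v. tens sV sA (q u) (p v))" for x
  define \<Delta>\<^sub>V where "\<Delta>\<^sub>V x = sweedler (\<Delta> (iV x)) (\<lambda>u v. tens sV sV (q u) (q v))" for x
  note mult_defs = lact_def ract_def \<theta>_def mV_def
  note comult_defs = \<phi>_def \<psi>_def P_def \<rho>_def \<gamma>_def \<Delta>\<^sub>V_def

  interpret extending_datum sA sV mA \<Delta>\<^sub>A lact ract \<theta> P mV \<phi> \<psi> \<rho> \<gamma> \<Delta>\<^sub>V
    unfolding extending_datum_def extending_datum_axioms_def mult_defs comult_defs
    by (intro conjI vs bialgebra_A linear_to_tensors_map[OF l\<Delta>] iA iV p q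
        bilinear_map_compose[OF bilinear_map_precompose[OF bmE] q])

  let ?f = "\<lambda>(a, x). iA a + iV x" and ?g = "\<lambda>e. (p e, q e)"
  have f_linear: "Vector_Spaces.linear scaleE sE ?f"
    using iA iV vector_space_scaleE vs(3) vector_space.vector_space_assms(1)[OF vs(3)]
    unfolding Vector_Spaces.linear_iff by (auto simp: scaleE_apply algebra_simps)
  have g_linear: "Vector_Spaces.linear sE scaleE ?g"
    using p q vector_space_scaleE
    unfolding Vector_Spaces.linear_iff by (auto simp: scaleE_apply)
  \<comment> \<open>Multiplicativity of \<open>p\<close> gives the first component, biadditivity of
    \<open>mE\<close> the second.\<close>
  have mult_E: "mult_E e e' = ?g (mE (?f e) (?f e'))" for e e'
  proof -
    obtain a x b y where e: "e = (a, x)" "e' = (b, y)" by (cases e, cases e')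
    have "q (u + v) = q u + q v" for u v
      using q unfolding Vector_Spaces.linear_iff by blast
    then have "q (mE (iA a + iV x) (iA b + iV y)) = mV x y + lact a y + ract x b + \<theta> a b"
      by (simp add: D.m_add mult_defs algebra_simps)
    then show ?thesis
      by (simp only: e mult_E.simps prod.case p_mult proj)
  qed
  have Delta_A: "\<Delta>\<^sub>A (p e) \<beta> = \<Delta> e (\<lambda>u v. \<beta> (p u) (p v))" if "bilinear_map sA sA (*) \<beta>" for e \<beta>
  proof -
    have "\<Delta>\<^sub>A (p e) = sweedler (\<Delta> e) (\<lambda>u v. tens sA sA (p u) (p v))"
      using coalg_hom unfolding coalgebra_hom_def by simp
    then show ?thesis using that by (simp add: sweedler_apply tens_apply)
  qed
  have Delta_E: "Delta_E e = sweedler (\<Delta> (?f e)) (\<lambda>u v. tens scaleE scaleE (?g u) (?g v))" for e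
  proof
    fix \<beta>
    obtain a x where e: "e = (a, x)" by (cases e)
    show "Delta_E e \<beta> = sweedler (\<Delta> (?f e)) (\<lambda>u v. tens scaleE scaleE (?g u) (?g v)) \<beta>"
    proof (cases "bilinear_map scaleE scaleE (*) \<beta>")
      case True
      note restr = restrict_forms[OF True]
      have blocks: "\<Delta> e' (\<lambda>u v. \<beta> (?g u) (?g v)) =
          (\<Delta> e' (\<lambda>u v. \<beta> (p u, 0) (p v, 0)) + \<Delta> e' (\<lambda>u v. \<beta> (p u, 0) (0, q v))) +
          (\<Delta> e' (\<lambda>u v. \<beta> (0, q u) (p v, 0)) + \<Delta> e' (\<lambda>u v. \<beta> (0, q u) (0, q v)))" for e'
        by (subst form_blocks[OF True])
          (simp add: D.D_add_form bilinear_map_add bilinear_map_precompose[OF restr(1) p p]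
            bilinear_map_precompose[OF restr(2) p q] bilinear_map_precompose[OF restr(3) q p]
            bilinear_map_precompose[OF restr(4) q q])
      \<comment> \<open>As \<open>p\<close> vanishes on \<open>V\<close>, the coalgebra homomorphism
        property makes the \<open>A \<otimes> A\<close> block \<open>\<Delta>\<^sub>A\<close> on
        \<open>A\<close> and 0 on \<open>V\<close>.\<close>
      have "p (iA a) = a" "p (iV x) = 0"
        using proj[of a 0] proj[of 0 x] by (simp_all add: zero)
      then have AA: "\<Delta>\<^sub>A a (\<lambda>u v. \<beta> (u, 0) (v, 0)) = \<Delta> (iA a) (\<lambda>u v. \<beta> (p u, 0) (p v, 0))"
        "\<Delta> (iV x) (\<lambda>u v. \<beta> (p u, 0) (p v, 0)) = 0"
        using Delta_A[OF restr(1), of "iA a"] Delta_A[OF restr(1), of "iV x"]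
        by (simp_all add: data_zero)
      show ?thesis
        by (simp add: e Delta_E_apply[OF True] True restr sweedler_apply tens_apply
            linear_to_tensors_add[OF l\<Delta>] blocks AA comult_defs)
    next
      case False
      then show ?thesis
        by (simp add: e sweedler_apply tens_apply_not_bilinear data_zero D.D_zero)
    qed
  qed
  \<comment> \<open>By the two formulas above, the biproduct is the structure of \<open>E\<close>
    pulled back along \<open>?f\<close>.\<close>
  have "antiflexible_bialgebra scaleE mult_E Delta_E"
    by (rule antiflexible_bialgebra_transport[OF bialgebra f_linear g_linear _ mult_E Delta_E]) (simp add: fg)
  then have "biproduct_conditions" by (simp only: biproduct_iff)
  moreover have "algebra_hom scaleE mult_E sE mE ?f"
    using f_linear by (simp add: algebra_hom_def mult_E fg)
  moreover have "coalgebra_hom scaleE Delta_E sE \<Delta> ?f"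
    unfolding coalgebra_hom_def
  proof (intro conjI allI ext f_linear)
    fix e \<beta>
    show "sweedler (Delta_E e) (\<lambda>u v. tens sE sE (?f u) (?f v)) \<beta> = \<Delta> (?f e) \<beta>"
    proof (cases "bilinear_map sE sE (*) \<beta>")
      case True
      \<comment> \<open>The form pulled back along \<open>?f\<close> is bilinear, so the tensors
        inside \<open>Delta_E\<close> evaluate it, and \<open>?f\<close> cancels
        \<open>?g\<close>.\<close>
      have "bilinear_map scaleE scaleE (*) (\<lambda>u v. \<beta> (?f u) (?f v))"
        by (rule bilinear_map_precompose[OF True f_linear f_linear])
      with True show ?thesis
        by (simp add: Delta_E sweedler_apply tens_apply fg)
    next
      case False
      then show ?thesis
        by (simp add: Delta_E sweedler_apply tens_apply_not_bilinear D.D_not_bilinear D.D_zero tens_def)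
    qed
  qed
  ultimately show ?thesis using extending_datum_axioms by blast
qed

theorem theorem5p15:
  fixes sA :: "'k::field_char_0 \<Rightarrow> 'a::ab_group_add \<Rightarrow> 'a"
    and sV :: "'k \<Rightarrow> 'v::ab_group_add \<Rightarrow> 'v"
    and mA :: "'a \<Rightarrow> 'a \<Rightarrow> 'a"
    and \<Delta>\<^sub>A :: "'a \<Rightarrow> ('a, 'a, 'k) tensor2"
  assumes "vector_space sA" and "vector_space sV"
    and "antiflexible_bialgebra sA mA \<Delta>\<^sub>A"
  shows "(\<forall>lact ract \<theta> P mV \<phi> \<psi> \<rho> \<gamma> \<Delta>\<^sub>V.
      extending_datum sA sV mA \<Delta>\<^sub>A lact ract \<theta> P mV \<phi> \<psi> \<rho> \<gamma> \<Delta>\<^sub>V \<longrightarrow>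
      (antiflexible_bialgebra (module_prod.scale sA sV)
         (extending_datum.mult_E mA lact ract \<theta> mV)
         (extending_datum.Delta_E sA sV \<Delta>\<^sub>A P \<phi> \<psi> \<rho> \<gamma> \<Delta>\<^sub>V)
       \<longleftrightarrow> extending_datum.biproduct_conditions sA sV mA \<Delta>\<^sub>A lact ract \<theta> P mV \<phi> \<psi> \<rho> \<gamma> \<Delta>\<^sub>V))
    \<and>
    (\<forall>(sE :: 'k \<Rightarrow> 'e::ab_group_add \<Rightarrow> 'e) iA iV mE \<Delta> p.
      vector_space sE \<longrightarrow>
      complemented_inclusion sA sV sE iA iV \<longrightarrow>
      (\<forall>a x. p (iA a + iV x) = a) \<longrightarrow>
      antiflexible_bialgebra sE mE \<Delta> \<longrightarrow>
      algebra_hom sE mE sA mA p \<longrightarrow>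
      coalgebra_hom sE \<Delta> sA \<Delta>\<^sub>A p \<longrightarrow>
      (\<exists>lact ract \<theta> P mV \<phi> \<psi> \<rho> \<gamma> \<Delta>\<^sub>V.
        extending_datum sA sV mA \<Delta>\<^sub>A lact ract \<theta> P mV \<phi> \<psi> \<rho> \<gamma> \<Delta>\<^sub>V \<and>
        extending_datum.biproduct_conditions sA sV mA \<Delta>\<^sub>A lact ract \<theta> P mV \<phi> \<psi> \<rho> \<gamma> \<Delta>\<^sub>V \<and>
        algebra_hom (module_prod.scale sA sV) (extending_datum.mult_E mA lact ract \<theta> mV)
          sE mE (\<lambda>(a, x). iA a + iV x) \<and>
        coalgebra_hom (module_prod.scale sA sV)
          (extending_datum.Delta_E sA sV \<Delta>\<^sub>A P \<phi> \<psi> \<rho> \<gamma> \<Delta>\<^sub>V)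
          sE \<Delta> (\<lambda>(a, x). iA a + iV x)))"
proof (intro conjI allI impI, goal_cases)
  case 1
  then show ?case by (rule extending_datum.biproduct_iff)
next
  case 2
  then show ?case by (intro extension_is_biproduct[OF assms(3)]) auto
qed

end
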